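(* Let $n\ge 1$, let $A,B\in\mathbb{M}_n$ be Hermitian and let $f$ be a real-valued convex function defined on an interval containing the spectra of $A$ and $B$. If $X,Y\in\mathbb{M}_n$ satisfy $X^*X+Y^*Y=XX^*+YY^*=I$, then there exist unitary matrices $U_1,\dots,U_{2n}\in\mathbb{M}_{2n}$ such that $$ f(X^*AX+Y^*BY)\oplus f(Y^*AY+X^*BX)\le\frac{1}{2n}\sum_{k=1}^{2n}U_k f(A\oplus B)U_k^*. $$
   Context: $\mathbb{M}_d$ is the space of $d\times d$ complex matrices and $I$ is the identity of $\mathbb{M}_n$. For Hermitian $S,T$, $S\le T$ means that $T-S$ is positive semidefinite. $S\oplus T$ is the block-diagonal matrix with diagonal blocks $S,T$. $f(Z)$ is defined for Hermitian $Z$ by functional calculus. *)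

theory Defs
  imports
    "HOL-Analysis.Analysis"
    "Jordan_Normal_Form.Spectral_Radius"
    "Jordan_Normal_Form.Schur_Decomposition"
begin

definition hermitian :: "nat \<Rightarrow> complex mat \<Rightarrow> bool" where
  "hermitian d S \<longleftrightarrow> S \<in> carrier_mat d d \<and> mat_adjoint S = S"

definition unitary :: "nat \<Rightarrow> complex mat \<Rightarrow> bool" where
  "unitary d U \<longleftrightarrow> U \<in> carrier_mat d d \<and>
     mat_adjoint U * U = 1\<^sub>m d \<and> U * mat_adjoint U = 1\<^sub>m d"

(* conjugation sits on the second argument of \<bullet>c, so the quadratic form is v^* P v *)
definition psd :: "nat \<Rightarrow> complex mat \<Rightarrow> bool" where
  "psd d P \<longleftrightarrow> hermitian d P \<and> (\<forall>v \<in> carrier_vec d. 0 \<le> Re ((P *\<^sub>v v) \<bullet>c v))"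

definition loewner_le :: "nat \<Rightarrow> complex mat \<Rightarrow> complex mat \<Rightarrow> bool" where
  "loewner_le d S T \<longleftrightarrow> hermitian d S \<and> hermitian d T \<and> psd d (T - S)"

definition direct_sum_mat :: "complex mat \<Rightarrow> complex mat \<Rightarrow> complex mat" where
  "direct_sum_mat S T =
     four_block_mat S (0\<^sub>m (dim_row S) (dim_col T)) (0\<^sub>m (dim_row T) (dim_col S)) T"

definition spectral_decomp :: "nat \<Rightarrow> complex mat \<Rightarrow> complex mat \<Rightarrow> (nat \<Rightarrow> real) \<Rightarrow> bool" where
  "spectral_decomp d Z U l \<longleftrightarrow> unitary d U \<and>
     Z = U * mat_diag d (\<lambda>i. complex_of_real (l i)) * mat_adjoint U"

(* Functional calculus: apply f to the eigenvalues in any unitary diagonalization of Z.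
   The result does not depend on the diagonalization (fun_calc_eqI below); for Hermitian Z
   a diagonalization exists by the spectral theorem. *)
definition fun_calc :: "(real \<Rightarrow> real) \<Rightarrow> complex mat \<Rightarrow> complex mat" where
  "fun_calc f Z = (THE F. \<exists>U l. spectral_decomp (dim_row Z) Z U l \<and>
     F = U * mat_diag (dim_row Z) (\<lambda>i. complex_of_real (f (l i))) * mat_adjoint U)"

lemma mat_adjoint_carrier: "U \<in> carrier_mat r c \<Longrightarrow> mat_adjoint U \<in> carrier_mat c r"
  unfolding mat_adjoint_def by (auto intro!: carrier_matI)

lemma fun_calc_well_defined:
  assumes 1: "spectral_decomp d Z U l" and 2: "spectral_decomp d Z V m"
  shows "U * mat_diag d (\<lambda>i. complex_of_real (f (l i))) * mat_adjoint U
       = V * mat_diag d (\<lambda>i. complex_of_real (f (m i))) * mat_adjoint V"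
proof -
  let ?D = "mat_diag d (\<lambda>i. complex_of_real (l i))"
  let ?E = "mat_diag d (\<lambda>i. complex_of_real (m i))"
  let ?fD = "mat_diag d (\<lambda>i. complex_of_real (f (l i)))"
  let ?fE = "mat_diag d (\<lambda>i. complex_of_real (f (m i)))"
  have U: "U \<in> carrier_mat d d" and V: "V \<in> carrier_mat d d"
    and UU: "mat_adjoint U * U = 1\<^sub>m d" "U * mat_adjoint U = 1\<^sub>m d"
    and VV: "mat_adjoint V * V = 1\<^sub>m d" "V * mat_adjoint V = 1\<^sub>m d"
    and eq: "U * ?D * mat_adjoint U = V * ?E * mat_adjoint V"
    using 1 2 unfolding spectral_decomp_def unitary_def by auto
  define U' V' W where "U' = mat_adjoint U" and "V' = mat_adjoint V" and "W = V' * U"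
  have U': "U' \<in> carrier_mat d d" and V': "V' \<in> carrier_mat d d"
    using U V mat_adjoint_carrier unfolding U'_def V'_def by auto
  have W: "W \<in> carrier_mat d d" using U V' unfolding W_def by simp
  note c = U V U' V' W
  note uv = UU[folded U'_def] VV[folded V'_def]
  have D: "mat_diag d g \<in> carrier_mat d d" for g :: "nat \<Rightarrow> complex" by simp
  have as: "P * Q * R = P * (Q * R)"
    if "P \<in> carrier_mat d d" "Q \<in> carrier_mat d d" "R \<in> carrier_mat d d" for P Q R :: "complex mat"
    using assoc_mult_mat[OF that] .
  have cl: "P * Q \<in> carrier_mat d d"
    if "P \<in> carrier_mat d d" "Q \<in> carrier_mat d d" for P Q :: "complex mat"
    using that by simp
  have one: "P * 1\<^sub>m d = P" "1\<^sub>m d * P = P" if "P \<in> carrier_mat d d" for P :: "complex mat"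
    using that by auto
  have can: "V' * (V * P) = P" "V * (V' * P) = P" "U * (U' * P) = P" "U' * (U * P) = P"
    if "P \<in> carrier_mat d d" for P
    using that c uv by (simp_all add: as[symmetric] one)
  have "W * ?D = V' * (U * ?D * U') * U"
    unfolding W_def using c D uv by (simp add: as cl one can)
  also have "\<dots> = V' * (V * ?E * V') * U" using eq unfolding U'_def V'_def by simp
  also have "\<dots> = (V' * V) * ?E * W" unfolding W_def using c D by (simp add: as cl one can)
  finally have WD: "W * ?D = ?E * W" using uv W D by (simp add: one cl)
  have "W * ?fD = ?fE * W"
  proof (rule eq_matI)
    fix i j assume "i < dim_row (?fE * W)" "j < dim_col (?fE * W)"
    hence ij: "i < d" "j < d" using W by (auto simp: mat_diag_def)
    have "W $$ (i,j) * complex_of_real (l j) = complex_of_real (m i) * W $$ (i,j)"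
      using arg_cong[OF WD, of "\<lambda>M. M $$ (i,j)"] ij
      by (simp add: mat_diag_mult_left[OF W] mat_diag_mult_right[OF W])
    hence "W $$ (i,j) = 0 \<or> l j = m i" by auto
    thus "(W * ?fD) $$ (i,j) = (?fE * W) $$ (i,j)"
      using ij by (auto simp: mat_diag_mult_left[OF W] mat_diag_mult_right[OF W])
  qed (use W in \<open>auto simp: mat_diag_def\<close>)
  hence "V * (W * ?fD) * U' = V * (?fE * W) * U'" by simp
  moreover have "V * (W * ?fD) * U' = (V * V') * U * ?fD * U'"
    unfolding W_def using c D by (simp add: as cl one can)
  moreover have "V * (?fE * W) * U' = V * ?fE * (V' * (U * U'))"
    unfolding W_def using c D by (simp add: as cl one can)
  ultimately show ?thesis using uv c D unfolding U'_def[symmetric] V'_def[symmetric] by (simp add: as cl one can)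
qed

lemma fun_calc_eqI:
  assumes "spectral_decomp d Z U l"
  shows "fun_calc f Z = U * mat_diag d (\<lambda>i. complex_of_real (f (l i))) * mat_adjoint U"
proof -
  have d: "dim_row Z = d"
    using assms unfolding spectral_decomp_def unitary_def by auto
  show ?thesis unfolding fun_calc_def d
    by (rule the_equality) (use assms fun_calc_well_defined in blast)+
qed

end

theory Submission
  imports Defs
begin

text \<open>
  Why the theorem holds. Diagonalise \<open>A\<close>, \<open>B\<close> and the two compressions
  \<open>M = X\<^sup>*AX + Y\<^sup>*BY\<close> and \<open>N = Y\<^sup>*AY + X\<^sup>*BX\<close>. Each eigenvalue of \<open>M \<oplus> N\<close> is a weighted mean
  of the eigenvalues of \<open>A \<oplus> B\<close>; the weights are the squared moduli of the entries of \<open>X\<close> and \<open>Y\<close>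
  taken between the two eigenbases. The relation \<open>X\<^sup>*X + Y\<^sup>*Y = I\<close> makes each row of weights sum to
  1, and \<open>XX\<^sup>* + YY\<^sup>* = I\<close> makes each column sum to 1, so the weights form a doubly stochastic
  matrix \<open>P\<close>. Jensen's inequality then bounds the eigenvalues of \<open>f(M) \<oplus> f(N)\<close> entrywise by
  \<open>t = P s\<close>, where \<open>s\<close> lists the eigenvalues of \<open>f(A \<oplus> B)\<close>.

  The vector \<open>t\<close> is majorised by \<open>s\<close>, so by Horn's theorem
  (\<open>hinge_majorizes_imp_orthostochastic\<close>) some unitary conjugate of \<open>diag s\<close> has diagonal \<open>t\<close>.
  Horn's theorem cannot be bypassed by taking \<open>P\<close> itself, since \<open>P\<close> need not consist of the squared moduli of the
  entries of a unitary matrix. Finally, averaging a \<open>d \<times> d\<close> matrix over its conjugates by \<open>d\<close>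
  diagonal matrices of \<open>d\<close>-th roots of unity deletes all off-diagonal entries
  (\<open>finsum_phase_conj\<close>). With \<open>d = 2n\<close> this writes \<open>diag t\<close>, rotated into the eigenbasis of
  \<open>f(M) \<oplus> f(N)\<close>, as an average of exactly \<open>2n\<close> unitary conjugates of \<open>f(A \<oplus> B)\<close>; this is
  \<open>loewner_le_average_of_unitary_orbit\<close>.
\<close>

section \<open>Majorisation and Horn's theorem\<close>

text \<open>
  For finite families of equal size this is ordinary majorisation of \<open>t\<close> by \<open>s\<close>, expressed without
  sorting: for fixed \<open>c\<close> the worst set \<open>I\<close> is \<open>{i. t i > c}\<close>, which turns the left-hand side into the sum of the positive parts of
  \<open>t i - c\<close>. Letting \<open>I\<close> vary freely makes it possible to keep \<open>I\<close> while changing \<open>c\<close>, which is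
  how the inductive step of Horn's theorem is proved.
\<close>

definition hinge_majorizes :: "'b set \<Rightarrow> ('b \<Rightarrow> real) \<Rightarrow> 'a set \<Rightarrow> ('a \<Rightarrow> real) \<Rightarrow> bool" where
  "hinge_majorizes S s T t \<longleftrightarrow> sum t T = sum s S \<and>
     (\<forall>I c. I \<subseteq> T \<longrightarrow> (\<Sum>i\<in>I. t i - c) \<le> (\<Sum>j\<in>S. max (s j - c) 0))"

text \<open>
  Hinge functions are convex, so row sums equal to 1 give Jensen's inequality for each \<open>i\<close>; column sums equal
  to 1 then collapse the double sum.
\<close>

lemma hinge_majorizes_doubly_stochastic:
  fixes P :: "'a \<Rightarrow> 'b \<Rightarrow> real"
  assumes fin: "finite T" "finite S"
    and nonneg: "\<And>i j. i \<in> T \<Longrightarrow> j \<in> S \<Longrightarrow> 0 \<le> P i j"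
    and row: "\<And>i. i \<in> T \<Longrightarrow> (\<Sum>j\<in>S. P i j) = 1"
    and col: "\<And>j. j \<in> S \<Longrightarrow> (\<Sum>i\<in>T. P i j) = 1"
  shows "hinge_majorizes S s T (\<lambda>i. \<Sum>j\<in>S. P i j * s j)"
  unfolding hinge_majorizes_def
proof (intro conjI allI impI)
  have "(\<Sum>i\<in>T. \<Sum>j\<in>S. P i j * s j) = (\<Sum>j\<in>S. (\<Sum>i\<in>T. P i j) * s j)"
    by (subst sum.swap) (simp add: sum_distrib_right)
  also have "\<dots> = sum s S" using col by simp
  finally show "(\<Sum>i\<in>T. \<Sum>j\<in>S. P i j * s j) = sum s S" .
next
  fix I c assume I: "I \<subseteq> T"
  have "(\<Sum>i\<in>I. (\<Sum>j\<in>S. P i j * s j) - c) = (\<Sum>i\<in>I. \<Sum>j\<in>S. P i j * (s j - c))"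
  proof (rule sum.cong[OF refl])
    fix i assume "i \<in> I"
    hence "(\<Sum>j\<in>S. P i j) = 1" using row I by auto
    thus "(\<Sum>j\<in>S. P i j * s j) - c = (\<Sum>j\<in>S. P i j * (s j - c))"
      by (simp add: right_diff_distrib sum_subtractf flip: sum_distrib_right)
  qed
  also have "\<dots> \<le> (\<Sum>i\<in>I. \<Sum>j\<in>S. P i j * max (s j - c) 0)"
    using I nonneg by (intro sum_mono mult_left_mono) auto
  also have "\<dots> \<le> (\<Sum>i\<in>T. \<Sum>j\<in>S. P i j * max (s j - c) 0)"
    using I fin nonneg by (intro sum_mono2) (auto intro!: sum_nonneg)
  also have "\<dots> = (\<Sum>j\<in>S. (\<Sum>i\<in>T. P i j) * max (s j - c) 0)"
    by (subst sum.swap) (simp add: sum_distrib_right)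
  also have "\<dots> = (\<Sum>j\<in>S. max (s j - c) 0)" using col by simp
  finally show "(\<Sum>i\<in>I. (\<Sum>j\<in>S. P i j * s j) - c) \<le> (\<Sum>j\<in>S. max (s j - c) 0)" .
qed

text \<open>
  An entry of the majorised family lies between the extreme entries of \<open>s\<close>, hence it either equals
  an entry of \<open>s\<close> or falls in a gap between two neighbouring values of \<open>s\<close>.
\<close>

lemma hinge_majorizes_adjacent_pair:
  assumes fin: "finite T" "finite S" and card: "card T = card S" "card S \<ge> 2"
    and maj: "hinge_majorizes S s T t" and i0: "i0 \<in> T"
  obtains j k where "j \<in> S" "k \<in> S" "j \<noteq> k" "s k \<le> t i0" "t i0 \<le> s j"
      "\<And>l. l \<in> S \<Longrightarrow> s l \<le> s k \<or> s j \<le> s l"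
    | j k where "j \<in> S" "k \<in> S" "j \<noteq> k" "s j = t i0"
proof (cases "\<exists>j\<in>S. s j = t i0")
  case True
  then obtain j where j: "j \<in> S" "s j = t i0" by auto
  have "\<not> S \<subseteq> {j}" using card(2) card_mono[of "{j}" S] by auto
  then obtain k where "k \<in> S" "k \<noteq> j" by auto
  thus ?thesis using j that(2) by metis
next
  case False
  let ?U = "{l\<in>S. t i0 \<le> s l}" and ?L = "{l\<in>S. s l \<le> t i0}"
  have S0: "S \<noteq> {}" using card by auto
  have maj': "\<And>I c. I \<subseteq> T \<Longrightarrow> (\<Sum>i\<in>I. t i - c) \<le> (\<Sum>j\<in>S. max (s j - c) 0)"
    and tot: "sum t T = sum s S" using maj unfolding hinge_majorizes_def by auto
  have U0: "?U \<noteq> {}"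
  proof
    assume "?U = {}"
    hence *: "\<And>l. l \<in> S \<Longrightarrow> s l < t i0" by force
    define c where "c = Max (s ` S)"
    have "c \<in> s ` S" unfolding c_def using fin S0 by (intro Max_in) auto
    hence c: "c < t i0" using * by auto
    have le: "s l \<le> c" if "l \<in> S" for l unfolding c_def using fin that by auto
    \<comment> \<open>Testing with a singleton at the maximum of \<open>s\<close> shows that no entry exceeds it.\<close>
    have "t i0 - c \<le> (\<Sum>j\<in>S. max (s j - c) 0)" using maj'[of "{i0}" c] i0 by simp
    also have "\<dots> = 0" using le by (intro sum.neutral) (auto simp: max_def)
    finally show False using c by simp
  qed
  have L0: "?L \<noteq> {}"
  proof
    assume "?L = {}"
    hence *: "\<And>l. l \<in> S \<Longrightarrow> t i0 < s l" by force
    define c where "c = Min (s ` S)"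
    have "c \<in> s ` S" unfolding c_def using fin S0 by (intro Min_in) auto
    hence c: "t i0 < c" using * by auto
    have le: "c \<le> s l" if "l \<in> S" for l unfolding c_def using fin that by auto
    \<comment> \<open>Dually, test with all other entries at the minimum of \<open>s\<close> and use that the totals agree.\<close>
    have "(\<Sum>i\<in>T-{i0}. t i - c) \<le> (\<Sum>j\<in>S. max (s j - c) 0)" using maj' by auto
    also have "\<dots> = (\<Sum>j\<in>S. s j - c)" using le by (intro sum.cong refl max_absorb1) simp
    also have "\<dots> = (\<Sum>i\<in>T. t i - c)" using tot card by (simp add: sum_subtractf)
    also have "\<dots> = (t i0 - c) + (\<Sum>i\<in>T-{i0}. t i - c)" using fin i0 by (simp add: sum.remove)
    finally show False using c by simp
  qed
  have finUL: "finite ?U" "finite ?L" using fin by auto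
  obtain j where j: "j \<in> ?U" "\<And>l. l \<in> ?U \<Longrightarrow> s j \<le> s l"
    using arg_min_if_finite(1)[OF finUL(1) U0, of s] arg_min_least[OF finUL(1) U0, of _ s] by blast
  obtain k where k: "k \<in> ?L" "\<And>l. l \<in> ?L \<Longrightarrow> - s k \<le> - s l"
    using arg_min_if_finite(1)[OF finUL(2) L0, of "\<lambda>l. - s l"]
      arg_min_least[OF finUL(2) L0, of _ "\<lambda>l. - s l"] by blast
  have "j \<noteq> k" using j(1) k(1) False by auto
  moreover have "s l \<le> s k \<or> s j \<le> s l" if "l \<in> S" for l
    using j(2)[of l] k(2)[of l] that by (cases "t i0 \<le> s l") auto
  ultimately show ?thesis using that(1)[of j k] j(1) k(1) by auto
qed

text \<open>
  Removing \<open>t i0\<close> from the gap between neighbours \<open>s k\<close> and \<open>s j\<close>, and replacing these two by what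
  remains of their sum, preserves majorisation. For \<open>c\<close> outside the gap the map \<open>x \<mapsto> max (x - c) 0\<close> is
  affine on the segment from \<open>s k\<close> to \<open>s j\<close>, so both sides lose the same amount. For \<open>c\<close> inside the
  gap let \<open>L\<close> be the set of untouched entries from \<open>s j\<close> upwards. The new right-hand side is at least
  the sum of \<open>x - c\<close> over \<open>L\<close>, whether or not the new entry is added; these two lower bounds have
  slopes \<open>- card L\<close> and \<open>- (card L + 1)\<close> in \<open>c\<close>, while the left-hand side has slope \<open>- card I\<close>.
  Comparing slopes transports the inequality from \<open>c = s j\<close> when \<open>card I \<le> card L\<close>, and from
  \<open>c = s k\<close> otherwise.
\<close>

lemma hinge_majorizes_reduce:
  fixes s :: "'b \<Rightarrow> real" and t :: "'a \<Rightarrow> real"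
  assumes fin: "finite T" "finite S"
    and maj: "hinge_majorizes S s T t" and i0: "i0 \<in> T"
    and jk: "j \<in> S" "k \<in> S" "j \<noteq> k" "s k \<le> t i0" "t i0 \<le> s j"
    and adj: "\<And>l. l \<in> S \<Longrightarrow> s l \<le> s k \<or> s j \<le> s l"
  shows "hinge_majorizes (S - {j}) (s(k := s j + s k - t i0)) (T - {i0}) t"
proof -
  define R where "R = S - {j,k}"
  define r where "r = s j + s k - t i0"
  have finR: "finite R" using fin R_def by auto
  have S: "S = insert j (insert k R)" "j \<notin> insert k R" "k \<notin> R" using jk R_def by auto
  have S': "S - {j} = insert k R" using S by auto
  have old: "sum (\<lambda>l. g (s l)) S = g (s j) + (g (s k) + (\<Sum>l\<in>R. g (s l)))" for g :: "real \<Rightarrow> real"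
    using S finR by simp
  have new: "sum (\<lambda>l. g ((s(k := r)) l)) (S - {j}) = g r + (\<Sum>l\<in>R. g (s l))" for g :: "real \<Rightarrow> real"
    unfolding S' using S finR by (simp, intro sum.cong) auto
  have maj': "\<And>I c. I \<subseteq> T \<Longrightarrow> (\<Sum>i\<in>I. t i - c) \<le> (\<Sum>j\<in>S. max (s j - c) 0)"
    and tot: "sum t T = sum s S" using maj unfolding hinge_majorizes_def by auto
  have total: "sum t (T - {i0}) = sum (s(k := r)) (S - {j})"
    using tot old[of "\<lambda>x. x"] new[of "\<lambda>x. x"] fin i0 unfolding r_def by (simp add: sum.remove)
  have outer: "(\<Sum>i\<in>I. t i - c) \<le> (\<Sum>l\<in>S-{j}. max ((s(k := r)) l - c) 0)"
    if I: "I \<subseteq> T - {i0}" and c: "c \<le> s k \<or> s j \<le> c" for I c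
  proof -
    have h: "max (s j - c) 0 + max (s k - c) 0 = max (t i0 - c) 0 + max (r - c) 0"
      using c jk unfolding r_def by (auto simp: max_def)
    have IT: "finite I" "i0 \<notin> I" "I \<subseteq> T" and ins_T: "insert i0 I \<subseteq> T"
      using I fin i0 by (auto intro: finite_subset)
    hence ins: "(\<Sum>i\<in>insert i0 I. t i - c) = (t i0 - c) + (\<Sum>i\<in>I. t i - c)" by simp
    have "(\<Sum>i\<in>I. t i - c) + max (t i0 - c) 0 \<le> (\<Sum>l\<in>S. max (s l - c) 0)"
      using maj'[OF IT(3), of c] maj'[OF ins_T, of c] ins by linarith
    thus ?thesis using old[of "\<lambda>x. max (x - c) 0"] new[of "\<lambda>x. max (x - c) 0"] h by linarith
  qed
  have "(\<Sum>i\<in>I. t i - c) \<le> (\<Sum>l\<in>S-{j}. max ((s(k := r)) l - c) 0)"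
    if I: "I \<subseteq> T - {i0}" for I c
  proof (cases "c \<le> s k \<or> s j \<le> c")
    case False
    hence c: "s k < c" "c < s j" by auto
    define L where "L = {l\<in>R. s j \<le> s l}"
    \<comment> \<open>By adjacency the entries outside \<open>L\<close> are at most \<open>s k\<close>, so they contribute nothing.\<close>
    have sumR: "(\<Sum>l\<in>R. max (s l - b) 0) = (\<Sum>l\<in>L. s l - b)" if "s k \<le> b" "b \<le> s j" for b
    proof -
      have "(\<Sum>l\<in>R. max (s l - b) 0) = (\<Sum>l\<in>L. max (s l - b) 0)"
        using finR adj that S by (intro sum.mono_neutral_right) (force simp: L_def)+
      also have "\<dots> = (\<Sum>l\<in>L. s l - b)" using that by (intro sum.cong) (auto simp: L_def)
      finally show ?thesis .
    qed
    have rb: "s k \<le> r" "r \<le> s j" using jk unfolding r_def by auto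
    have shiftT: "(\<Sum>i\<in>I. t i - c) = (\<Sum>i\<in>I. t i - b) - real (card I) * (c - b)" for b
      by (simp add: sum_subtractf algebra_simps)
    have shiftL: "(\<Sum>i\<in>L. s i - c) = (\<Sum>i\<in>L. s i - b) - real (card L) * (c - b)" for b
      by (simp add: sum_subtractf algebra_simps)
    have rhs: "(\<Sum>l\<in>S-{j}. max ((s(k := r)) l - b) 0) = max (r - b) 0 + (\<Sum>l\<in>L. s l - b)"
      if "s k \<le> b" "b \<le> s j" for b
      using new[of "\<lambda>x. max (x - b) 0"] sumR[OF that] by simp
    show ?thesis
    proof (cases "card I \<le> card L")
      case True
      have "(\<Sum>i\<in>I. t i - s j) \<le> (\<Sum>l\<in>L. s l - s j)"
        using outer[OF I, of "s j"] rhs[of "s j"] rb jk by simp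
      moreover have "real (card I) * (s j - c) \<le> real (card L) * (s j - c)"
        using True c by (intro mult_right_mono) auto
      ultimately show ?thesis
        unfolding rhs[OF less_imp_le[OF c(1)] less_imp_le[OF c(2)]] shiftT[of "s j"] shiftL[of "s j"]
        by (simp add: algebra_simps)
    next
      case False
      have "(\<Sum>i\<in>I. t i - s k) \<le> (r - s k) + (\<Sum>l\<in>L. s l - s k)"
        using outer[OF I, of "s k"] rhs[of "s k"] rb jk by simp
      moreover have "(real (card L) + 1) * (c - s k) \<le> real (card I) * (c - s k)"
        using False c by (intro mult_right_mono) auto
      ultimately show ?thesis
        unfolding rhs[OF less_imp_le[OF c(1)] less_imp_le[OF c(2)]] shiftT[of "s k"] shiftL[of "s k"]
        by (simp add: algebra_simps)
    qed
  qed (rule outer[OF I])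
  thus ?thesis using total unfolding hinge_majorizes_def r_def by auto
qed

lemma hinge_majorizes_reduce_equal:
  fixes s :: "'b \<Rightarrow> real" and t :: "'a \<Rightarrow> real"
  assumes fin: "finite T" "finite S"
    and maj: "hinge_majorizes S s T t" and i0: "i0 \<in> T" and j: "j \<in> S" "s j = t i0"
  shows "hinge_majorizes (S - {j}) s (T - {i0}) t"
  unfolding hinge_majorizes_def
proof (intro conjI allI impI)
  have maj': "\<And>I c. I \<subseteq> T \<Longrightarrow> (\<Sum>i\<in>I. t i - c) \<le> (\<Sum>j\<in>S. max (s j - c) 0)"
    and tot: "sum t T = sum s S" using maj unfolding hinge_majorizes_def by auto
  show "sum t (T - {i0}) = sum s (S - {j})" using tot fin i0 j by (simp add: sum.remove)
  fix I c assume I: "I \<subseteq> T - {i0}"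
  have IT: "finite I" "i0 \<notin> I" "I \<subseteq> T" and ins_T: "insert i0 I \<subseteq> T"
      using I fin i0 by (auto intro: finite_subset)
  hence ins: "(\<Sum>i\<in>insert i0 I. t i - c) = (t i0 - c) + (\<Sum>i\<in>I. t i - c)" by simp
  have "(\<Sum>i\<in>I. t i - c) + max (t i0 - c) 0 \<le> (\<Sum>l\<in>S. max (s l - c) 0)"
    using maj'[OF IT(3), of c] maj'[OF ins_T, of c] ins by linarith
  also have "\<dots> = max (s j - c) 0 + (\<Sum>l\<in>S-{j}. max (s l - c) 0)"
    using fin j by (simp add: sum.remove)
  finally show "(\<Sum>i\<in>I. t i - c) \<le> (\<Sum>l\<in>S-{j}. max (s l - c) 0)" using j by simp
qed

text \<open>
  Horn's theorem, by induction on the size. One plane rotation, with coefficients \<open>a\<close> and \<open>b\<close>,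
  mixes two neighbouring entries of \<open>diag s\<close> so that \<open>t i0\<close> appears on the diagonal. Deleting that
  row and column leaves a diagonal matrix again, which still majorises the remaining entries of \<open>t\<close>. The
  matrix supplied by the induction hypothesis is composed with this rotation.
\<close>

lemma hinge_majorizes_imp_orthostochastic:
  fixes s :: "'b \<Rightarrow> real" and t :: "'a \<Rightarrow> real"
  assumes "finite T" "finite S" "card T = card S" "hinge_majorizes S s T t"
  shows "\<exists>W :: 'a \<Rightarrow> 'b \<Rightarrow> real.
    (\<forall>i\<in>T. \<forall>i'\<in>T. (\<Sum>j\<in>S. W i j * W i' j) = (if i = i' then 1 else 0)) \<and>
    (\<forall>i\<in>T. (\<Sum>j\<in>S. (W i j)\<^sup>2 * s j) = t i)"
  using assms
proof (induction "card T" arbitrary: T S s)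
  case 0
  thus ?case by auto
next
  case (Suc m)
  note fin = Suc.prems(1,2) and card = Suc.prems(3) and maj = Suc.prems(4)
  obtain i0 where i0: "i0 \<in> T" using Suc(2) by (metis card_eq_0_iff ex_in_conv nat.distinct(1))
  show ?case
  proof (cases "card S = 1")
    case True
    then obtain j where S: "S = {j}" by (auto simp: card_1_singleton_iff)
    have T: "T = {i0}" using True card i0 by (auto simp: card_1_singleton_iff)
    have "t i0 = s j" using maj unfolding hinge_majorizes_def S T by simp
    thus ?thesis unfolding S T by (intro exI[of _ "\<lambda>_ _. 1"]) auto
  next
    case False
    hence card2: "card S \<ge> 2" using Suc(2) card by linarith
    have "\<exists>j k a b. j \<in> S \<and> k \<in> S \<and> j \<noteq> k \<and> a\<^sup>2 + b\<^sup>2 = (1::real) \<and>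
        a\<^sup>2 * s j + b\<^sup>2 * s k = t i0 \<and>
        hinge_majorizes (S - {j}) (s(k := s j + s k - t i0)) (T - {i0}) t"
      using fin card card2 maj i0
    proof (cases rule: hinge_majorizes_adjacent_pair)
      case (1 j k)
      have red: "hinge_majorizes (S - {j}) (s(k := s j + s k - t i0)) (T - {i0}) t"
        by (rule hinge_majorizes_reduce[OF fin maj i0 1])
      show ?thesis
      proof (cases "s j = s k")
        case True
        thus ?thesis using red 1 by (intro exI[of _ j] exI[of _ k] exI[of _ 1] exI[of _ 0]) auto
      next
        case False
        define p where "p = (t i0 - s k) / (s j - s k)"
        have p: "0 \<le> p" "p \<le> 1" unfolding p_def using 1 False by (auto simp: field_simps)
        have "p * (s j - s k) = t i0 - s k" unfolding p_def using False by simp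
        hence "p * s j + (1 - p) * s k = t i0" by (simp add: algebra_simps)
        thus ?thesis using red 1 p
          by (intro exI[of _ j] exI[of _ k] exI[of _ "sqrt p"] exI[of _ "sqrt (1 - p)"]) auto
      qed
    next
      \<comment> \<open>The merged entry is then \<open>s k\<close> itself, so \<open>k\<close> can be any other index.\<close>
      case (2 j k)
      have "hinge_majorizes (S - {j}) s (T - {i0}) t"
        by (rule hinge_majorizes_reduce_equal[OF fin maj i0 2(1,4)])
      thus ?thesis using 2 by (intro exI[of _ j] exI[of _ k] exI[of _ 1] exI[of _ 0]) auto
    qed
    then obtain j k a b where jk: "j \<in> S" "k \<in> S" "j \<noteq> k" and ab: "a\<^sup>2 + b\<^sup>2 = (1::real)"
      and tau: "a\<^sup>2 * s j + b\<^sup>2 * s k = t i0"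
      and red: "hinge_majorizes (S - {j}) (s(k := s j + s k - t i0)) (T - {i0}) t"
      by blast
    define R where "R = S - {j,k}"
    define r where "r = s j + s k - t i0"
    have finR: "finite R" using fin R_def by auto
    have S: "S = insert j (insert k R)" and nin: "j \<notin> insert k R" "k \<notin> R" using jk R_def by auto
    have S': "S - {j} = insert k R" using S nin by auto
    have sumS: "sum g S = g j + (g k + sum g R)" and sumS': "sum g (S - {j}) = g k + sum g R"
      for g :: "'b \<Rightarrow> real" unfolding S' unfolding S using nin finR by auto
    have r: "r = a\<^sup>2 * s k + b\<^sup>2 * s j"
    proof -
      have "r = (a\<^sup>2 + b\<^sup>2) * s j + (a\<^sup>2 + b\<^sup>2) * s k - (a\<^sup>2 * s j + b\<^sup>2 * s k)"
        unfolding r_def ab tau by simp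
      thus ?thesis by (simp add: algebra_simps)
    qed
    have "\<exists>W. (\<forall>i\<in>T-{i0}. \<forall>i'\<in>T-{i0}. (\<Sum>l\<in>S-{j}. W i l * W i' l) = (if i = i' then 1 else 0)) \<and>
      (\<forall>i\<in>T-{i0}. (\<Sum>l\<in>S-{j}. (W i l)\<^sup>2 * (s(k := r)) l) = t i)"
    proof (rule Suc(1))
      show "m = card (T - {i0})" "card (T - {i0}) = card (S - {j})"
        using Suc(2) fin card i0 jk by auto
      show "finite (T - {i0})" "finite (S - {j})" using fin by auto
      show "hinge_majorizes (S - {j}) (s(k := r)) (T - {i0}) t" using red unfolding r_def .
    qed
    then obtain W where
      W1: "\<And>i i'. i \<in> T-{i0} \<Longrightarrow> i' \<in> T-{i0} \<Longrightarrow> W i k * W i' k + (\<Sum>l\<in>R. W i l * W i' l) = (if i = i' then 1 else 0)"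
      and W2': "\<And>i. i \<in> T-{i0} \<Longrightarrow> (W i k)\<^sup>2 * r + (\<Sum>l\<in>R. (W i l)\<^sup>2 * (s(k := r)) l) = t i"
      unfolding sumS' by auto
    have W2: "(W i k)\<^sup>2 * r + (\<Sum>l\<in>R. (W i l)\<^sup>2 * s l) = t i" if "i \<in> T - {i0}" for i
    proof -
      have "(\<Sum>l\<in>R. (W i l)\<^sup>2 * (s(k := r)) l) = (\<Sum>l\<in>R. (W i l)\<^sup>2 * s l)"
        using nin by (intro sum.cong) auto
      thus ?thesis using W2'[OF that] by simp
    qed
    \<comment> \<open>Row \<open>i0\<close> is the first row of the rotation; in the other rows, the column \<open>k\<close> of \<open>W\<close>, which
       stands for the merged entry \<open>r\<close>, is spread over \<open>j\<close> and \<open>k\<close> orthogonally to row \<open>i0\<close>.\<close>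
    define V where "V i l =
      (if i = i0 then (if l = j then a else if l = k then b else 0)
       else if l = j then - b * W i k else if l = k then a * W i k else W i l)" for i l
    have Vj: "V i j = (if i = i0 then a else - b * W i k)"
      and Vk: "V i k = (if i = i0 then b else a * W i k)" for i
      using jk unfolding V_def by auto
    have VR: "V i l = (if i = i0 then 0 else W i l)" if "l \<in> R" for i l
      using that nin unfolding V_def by auto
    have "(\<Sum>l\<in>S. V i l * V i' l) = (if i = i' then 1 else 0)" if "i \<in> T" "i' \<in> T" for i i'
    proof -
      have R: "(\<Sum>l\<in>R. V i l * V i' l) = (if i = i0 \<or> i' = i0 then 0 else (\<Sum>l\<in>R. W i l * W i' l))"
        by (auto simp: VR)
      have e: "b * W i k * (b * W i' k) + a * W i k * (a * W i' k) = W i k * W i' k"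
      proof -
        have "b * W i k * (b * W i' k) + a * W i k * (a * W i' k) = (a\<^sup>2 + b\<^sup>2) * (W i k * W i' k)"
          by (simp add: algebra_simps power2_eq_square)
        thus ?thesis unfolding ab by simp
      qed
      show ?thesis
        unfolding sumS R Vj Vk using W1[of i i'] that ab e by (auto simp: power2_eq_square)
    qed
    moreover have "(\<Sum>l\<in>S. (V i l)\<^sup>2 * s l) = t i" if "i \<in> T" for i
    proof -
      have R: "(\<Sum>l\<in>R. (V i l)\<^sup>2 * s l) = (if i = i0 then 0 else (\<Sum>l\<in>R. (W i l)\<^sup>2 * s l))"
        by (auto simp: VR)
      show ?thesis
        unfolding sumS R Vj Vk using W2[of i] that tau r by (auto simp: power2_eq_square algebra_simps)
    qed
    ultimately show ?thesis by (intro exI[of _ V]) auto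
  qed
qed

section \<open>Adjoints, unitaries and direct sums\<close>

lemma dim_mat_adjoint [simp]:
  "dim_row (mat_adjoint A) = dim_col A" "dim_col (mat_adjoint A) = dim_row A"
  unfolding mat_adjoint_def by auto

lemma index_mat_adjoint [simp]:
  fixes A :: "complex mat"
  assumes "i < dim_col A" "j < dim_row A"
  shows "mat_adjoint A $$ (i, j) = cnj (A $$ (j, i))"
  using assms unfolding mat_adjoint_def by (simp add: mat_of_rows_index)

lemma mat_adjoint_adjoint [simp]: "mat_adjoint (mat_adjoint A) = (A :: complex mat)"
  by (rule eq_matI) auto

lemma mat_adjoint_mult:
  fixes A B :: "complex mat"
  assumes "A \<in> carrier_mat n m" "B \<in> carrier_mat m k"
  shows "mat_adjoint (A * B) = mat_adjoint B * mat_adjoint A"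
  using assms by (intro eq_matI) (auto simp: scalar_prod_def mult.commute)

lemma mat_adjoint_mat_diag:
  "mat_adjoint (mat_diag n g) = mat_diag n (\<lambda>i. cnj (g i))"
  by (intro eq_matI) (auto simp: mat_diag_def)

lemma mat_adjoint_one [simp]: "mat_adjoint (1\<^sub>m n :: complex mat) = 1\<^sub>m n"
  by (intro eq_matI) auto

lemma mult_adjoint_diag_entry:
  assumes "S \<in> carrier_mat m n" "i < m"
  shows "(S * mat_adjoint S) $$ (i, i) = complex_of_real (\<Sum>j<n. (cmod (S $$ (i, j)))\<^sup>2)"
  using assms
  by (auto simp: scalar_prod_def complex_norm_square lessThan_atLeast0 simp del: of_real_power intro!: sum.cong)

lemma adjoint_mult_diag_entry:
  assumes "S \<in> carrier_mat m n" "j < n"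
  shows "(mat_adjoint S * S) $$ (j, j) = complex_of_real (\<Sum>i<m. (cmod (S $$ (i, j)))\<^sup>2)"
  using mult_adjoint_diag_entry[of "mat_adjoint S" n m j] assms mat_adjoint_carrier by auto

lemma conj_mat_diag_diag_entry:
  assumes S: "S \<in> carrier_mat m n" and i: "i < m"
  shows "(S * mat_diag n (\<lambda>j. complex_of_real (l j)) * mat_adjoint S) $$ (i, i)
    = complex_of_real (\<Sum>j<n. (cmod (S $$ (i, j)))\<^sup>2 * l j)"
  unfolding mat_diag_mult_right[OF S] using assms
  by (auto simp: scalar_prod_def complex_norm_square lessThan_atLeast0 mult_ac simp del: of_real_power intro!: sum.cong)

lemma unitaryI:
  assumes "U \<in> carrier_mat d d" "mat_adjoint U * U = 1\<^sub>m d"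
  shows "unitary d U"
  using assms mat_mult_left_right_inverse[OF mat_adjoint_carrier[OF assms(1)] assms(1)]
  unfolding unitary_def by auto

lemma unitaryD:
  assumes "unitary d U"
  shows "U \<in> carrier_mat d d" "mat_adjoint U \<in> carrier_mat d d"
    "mat_adjoint U * U = 1\<^sub>m d" "U * mat_adjoint U = 1\<^sub>m d"
  using assms mat_adjoint_carrier unfolding unitary_def by auto

lemma unitary_adjoint: "unitary d U \<Longrightarrow> unitary d (mat_adjoint U)"
  using mat_adjoint_carrier unfolding unitary_def by auto

lemma unitary_one: "unitary d (1\<^sub>m d)"
  unfolding unitary_def by simp

text \<open>
  Products of square matrices are normalised by these two rules with the dimension instantiated. A
  rule with a free inner dimension cannot be used by the simplifier, since that dimension occurs only
  in the side conditions.
\<close>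

lemma assoc_square:
  "P \<in> carrier_mat d d \<Longrightarrow> Q \<in> carrier_mat d d \<Longrightarrow> R \<in> carrier_mat d d \<Longrightarrow>
   P * Q * R = P * (Q * R :: complex mat)"
  by (rule assoc_mult_mat)

lemma mult_carrier_square:
  "P \<in> carrier_mat d d \<Longrightarrow> Q \<in> carrier_mat d d \<Longrightarrow> P * Q \<in> carrier_mat d d"
  by (rule mult_carrier_mat)

lemma unitary_cancel:
  assumes "unitary d U" "M \<in> carrier_mat d d"
  shows "mat_adjoint U * (U * M) = M" "U * (mat_adjoint U * M) = M"
  using assms unitaryD[OF assms(1)] by (simp_all flip: assoc_square)

lemma unitary_mult:
  assumes "unitary d U" "unitary d V"
  shows "unitary d (U * V)"
proof (rule unitaryI)
  note c = unitaryD[OF assms(1)] unitaryD[OF assms(2)]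
  show "U * V \<in> carrier_mat d d" using c by simp
  show "mat_adjoint (U * V) * (U * V) = 1\<^sub>m d"
    using c unitary_cancel(1)[OF assms(1)]
    by (simp add: mat_adjoint_mult[of _ d d _ d] assoc_square[of _ d] mult_carrier_square[of _ d])
qed

lemma unitary_mat_diag:
  assumes "\<And>i. i < d \<Longrightarrow> cmod (g i) = 1"
  shows "unitary d (mat_diag d g)"
proof (rule unitaryI)
  have "mat_diag d (\<lambda>i. cnj (g i) * g i) = 1\<^sub>m d"
    using assms by (intro eq_matI) (auto simp: mat_diag_def mult.commute[of "cnj _"] simp flip: complex_norm_square)
  thus "mat_adjoint (mat_diag d g) * mat_diag d g = 1\<^sub>m d"
    by (simp add: mat_adjoint_mat_diag)
qed simp

lemma direct_sum_carrier [simp]: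
  "A \<in> carrier_mat n n \<Longrightarrow> B \<in> carrier_mat m m \<Longrightarrow> direct_sum_mat A B \<in> carrier_mat (n + m) (n + m)"
  unfolding direct_sum_mat_def by simp

lemma direct_sum_mult:
  assumes "A \<in> carrier_mat n n" "A' \<in> carrier_mat n n" "B \<in> carrier_mat m m" "B' \<in> carrier_mat m m"
  shows "direct_sum_mat A B * direct_sum_mat A' B' = direct_sum_mat (A * A') (B * B')"
proof -
  have z: "0\<^sub>m n m \<in> carrier_mat n m" "0\<^sub>m m n \<in> carrier_mat m n" by auto
  have "four_block_mat A (0\<^sub>m n m) (0\<^sub>m m n) B * four_block_mat A' (0\<^sub>m n m) (0\<^sub>m m n) B' =
    four_block_mat (A * A' + 0\<^sub>m n m * 0\<^sub>m m n) (A * 0\<^sub>m n m + 0\<^sub>m n m * B')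
      (0\<^sub>m m n * A' + B * 0\<^sub>m m n) (0\<^sub>m m n * 0\<^sub>m n m + B * B')"
    by (rule mult_four_block_mat[OF assms(1) z assms(3) assms(2) z assms(4)])
  moreover have "A * A' + 0\<^sub>m n m * 0\<^sub>m m n = A * A'" "A * 0\<^sub>m n m + 0\<^sub>m n m * B' = 0\<^sub>m n m"
    "0\<^sub>m m n * A' + B * 0\<^sub>m m n = 0\<^sub>m m n" "0\<^sub>m m n * 0\<^sub>m n m + B * B' = B * B'"
    using assms by simp_all
  ultimately show ?thesis using assms unfolding direct_sum_mat_def by simp
qed

lemma direct_sum_adjoint:
  assumes "A \<in> carrier_mat n n" "B \<in> carrier_mat m m"
  shows "mat_adjoint (direct_sum_mat A B) = direct_sum_mat (mat_adjoint A) (mat_adjoint B)"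
  using assms mat_adjoint_carrier[OF assms(1)] mat_adjoint_carrier[OF assms(2)]
  unfolding direct_sum_mat_def by (intro eq_matI) auto

lemma direct_sum_mat_diag:
  "direct_sum_mat (mat_diag n g) (mat_diag m h) = mat_diag (n + m) (\<lambda>i. if i < n then g i else h (i - n))"
  unfolding direct_sum_mat_def by (intro eq_matI) (auto simp: mat_diag_def)

lemma unitary_direct_sum:
  assumes "unitary n U" "unitary m V"
  shows "unitary (n + m) (direct_sum_mat U V)"
proof (rule unitaryI)
  note c = unitaryD[OF assms(1)] unitaryD[OF assms(2)]
  show "direct_sum_mat U V \<in> carrier_mat (n + m) (n + m)" using c by simp
  show "mat_adjoint (direct_sum_mat U V) * direct_sum_mat U V = 1\<^sub>m (n + m)"
    using c by (simp add: direct_sum_adjoint[of _ n _ m] direct_sum_mult[of _ n _ _ m])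
      (simp add: direct_sum_mat_def)
qed

lemma spectral_decomp_direct_sum:
  assumes "spectral_decomp n A U l" "spectral_decomp m B V k"
  shows "spectral_decomp (n + m) (direct_sum_mat A B) (direct_sum_mat U V)
    (\<lambda>i. if i < n then l i else k (i - n))"
proof -
  have U: "unitary n U" and V: "unitary m V"
    and A: "A = U * mat_diag n (\<lambda>i. complex_of_real (l i)) * mat_adjoint U"
    and B: "B = V * mat_diag m (\<lambda>i. complex_of_real (k i)) * mat_adjoint V"
    using assms unfolding spectral_decomp_def by auto
  note c = unitaryD[OF U] unitaryD[OF V]
  have "direct_sum_mat A B = direct_sum_mat U V *
      direct_sum_mat (mat_diag n (\<lambda>i. complex_of_real (l i))) (mat_diag m (\<lambda>i. complex_of_real (k i))) *
      mat_adjoint (direct_sum_mat U V)"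
    unfolding A B using c
    by (simp add: direct_sum_adjoint[of _ n _ m] direct_sum_mult[of _ n _ _ m] mult_carrier_square)
  thus ?thesis unfolding spectral_decomp_def direct_sum_mat_diag
    using unitary_direct_sum[OF U V] by (simp add: if_distrib[of complex_of_real])
qed

lemma spectral_decomp_conj:
  assumes W: "unitary d W" and A: "spectral_decomp d A U l"
  shows "spectral_decomp d (W * A * mat_adjoint W) (W * U) l"
proof -
  have U: "unitary d U" and A: "A = U * mat_diag d (\<lambda>i. complex_of_real (l i)) * mat_adjoint U"
    using A unfolding spectral_decomp_def by auto
  show ?thesis unfolding spectral_decomp_def A
    using unitary_mult[OF W U] unitaryD[OF U] unitaryD[OF W]
    by (simp add: mat_adjoint_mult[of _ d d _ d] assoc_square[of _ d] mult_carrier_square[of _ d])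
qed

section \<open>The spectral theorem\<close>

lemma hermitian_spectral_decomp:
  assumes "spectral_decomp d A U l"
  shows "hermitian d A"
proof -
  have U: "unitary d U" and A: "A = U * mat_diag d (\<lambda>i. complex_of_real (l i)) * mat_adjoint U"
    using assms unfolding spectral_decomp_def by auto
  show ?thesis unfolding hermitian_def A
    using unitaryD[OF U]
    by (simp add: mat_adjoint_mult[of _ d d _ d] assoc_square[of _ d] mult_carrier_square[of _ d] mat_adjoint_mat_diag)
qed

lemma hermitian_conj:
  assumes "hermitian d A" "X \<in> carrier_mat d d"
  shows "hermitian d (mat_adjoint X * A * X)"
  using assms mat_adjoint_carrier[OF assms(2)]
  unfolding hermitian_def by (simp add: mat_adjoint_mult[of _ d d _ d] assoc_square[of _ d] mult_carrier_square[of _ d])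

lemma hermitian_add:
  assumes "hermitian d A" "hermitian d B"
  shows "hermitian d (A + B)"
proof -
  have "cnj (M $$ (j, i)) = M $$ (i, j)" if "hermitian d M" "i < d" "j < d" for M i j
    using that unfolding hermitian_def by (metis carrier_matD index_mat_adjoint)
  thus ?thesis using assms unfolding hermitian_def by (auto intro!: eq_matI)
qed

text \<open>
  Gram-Schmidt on a basis that starts with \<open>v\<close> gives orthogonal vectors starting with \<open>v\<close>;
  normalising them gives the columns of \<open>W\<close>.
\<close>

lemma unitary_with_first_column:
  fixes v :: "complex vec"
  assumes v: "v \<in> carrier_vec n" "v \<noteq> 0\<^sub>v n"
  shows "\<exists>W c. unitary n W \<and> col W 0 = c \<cdot>\<^sub>v v"
proof -
  have n: "n \<noteq> 0" using v by (metis carrier_vec_dim_vec eq_vecI index_zero_vec(2) carrier_vecD not_less_zero)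
  interpret cof_vec_space n "TYPE(complex)" .
  define b where "b = basis_completion v"
  define ws where "ws = gram_schmidt n b"
  from basis_completion[OF v, folded b_def]
  have dist_b: "distinct b" and indep: "\<not> lin_dep (set b)" and b: "set b \<subseteq> carrier_vec n"
    and hdb: "hd b = v" and len_b: "length b = n" by auto
  from hdb len_b n obtain vs where bv: "b = v # vs" by (cases b) auto
  from gram_schmidt_result[OF b dist_b indep refl, folded ws_def]
  have ws: "set ws \<subseteq> carrier_vec n" "corthogonal ws" "length ws = n"
    by (auto simp: len_b)
  have "hd ws = v" using gram_schmidt_hd[OF v(1), of vs, folded bv] unfolding ws_def .
  hence ws0: "ws ! 0 = v" using ws n by (cases ws) auto
  have wsi: "ws ! i \<in> carrier_vec n" if "i < n" for i using ws that by auto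
  define r where "r i = sqrt (\<Sum>k<n. (cmod (ws ! i $ k))\<^sup>2)" for i
  have sp: "ws ! i \<bullet>c ws ! j = (\<Sum>k<n. ws ! i $ k * cnj (ws ! j $ k))" if "i < n" "j < n" for i j
    using wsi[OF that(1)] wsi[OF that(2)] by (auto simp: scalar_prod_def lessThan_atLeast0)
  have r2: "complex_of_real (r i * r i) = ws ! i \<bullet>c ws ! i" if "i < n" for i
  proof -
    have "r i * r i = (\<Sum>k<n. (cmod (ws ! i $ k))\<^sup>2)"
      unfolding r_def by (simp add: sum_nonneg)
    thus ?thesis unfolding sp[OF that that] by (simp add: complex_norm_square del: of_real_power)
  qed
  have r0: "complex_of_real (r i) \<noteq> 0" if "i < n" for i
  proof
    assume "complex_of_real (r i) = 0"
    hence "ws ! i \<bullet>c ws ! i = 0" using r2[OF that] by simp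
    thus False using corthogonalD[OF ws(2), of i i] that ws(3) by simp
  qed
  define W where "W = mat n n (\<lambda>(i, j). ws ! j $ i / complex_of_real (r j))"
  have W: "W \<in> carrier_mat n n" unfolding W_def by simp
  have "mat_adjoint W * W = 1\<^sub>m n"
  proof (rule eq_matI)
    fix i j assume "i < dim_row (1\<^sub>m n :: complex mat)" "j < dim_col (1\<^sub>m n :: complex mat)"
    hence ij: "i < n" "j < n" by auto
    have "(mat_adjoint W * W) $$ (i, j)
        = (\<Sum>k<n. cnj (ws ! i $ k / complex_of_real (r i)) * (ws ! j $ k / complex_of_real (r j)))"
      using W ij by (auto simp: scalar_prod_def lessThan_atLeast0 W_def intro!: sum.cong)
    also have "\<dots> = (\<Sum>k<n. ws ! j $ k * cnj (ws ! i $ k)) / complex_of_real (r i * r j)"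
      by (simp add: sum_divide_distrib mult.commute)
    also have "\<dots> = (ws ! j \<bullet>c ws ! i) / complex_of_real (r i * r j)" using sp ij by simp
    also have "\<dots> = (if i = j then 1 else 0)"
      using corthogonalD[OF ws(2), of j i] ij ws(3) r2[of j] r0[of j] by auto
    finally show "(mat_adjoint W * W) $$ (i, j) = 1\<^sub>m n $$ (i, j)" using ij by simp
  qed (use W in auto)
  hence "unitary n W" by (rule unitaryI[OF W])
  moreover have "col W 0 = (1 / complex_of_real (r 0)) \<cdot>\<^sub>v v"
    using n v ws0 unfolding W_def by (intro eq_vecI) auto
  ultimately show ?thesis by blast
qed

text \<open>
  In an orthonormal basis that starts with an eigenvector, the first column of a Hermitian matrix
  vanishes below the diagonal, hence so does the first row to the right of it. The matrix therefore splits as a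
  direct sum of a real 1-by-1 block and a smaller Hermitian block.
\<close>

lemma spectral_decomp_exists:
  assumes "hermitian d A"
  shows "\<exists>U l. spectral_decomp d A U l"
  using assms
proof (induction d arbitrary: A)
  case 0
  hence "spectral_decomp 0 A (1\<^sub>m 0) (\<lambda>_. 0)"
    unfolding spectral_decomp_def hermitian_def using unitary_one by (auto intro!: eq_matI)
  thus ?case by blast
next
  case (Suc m)
  have A: "A \<in> carrier_mat (Suc m) (Suc m)" and herm: "mat_adjoint A = A"
    using Suc.prems unfolding hermitian_def by auto
  obtain e v where "eigenvector A v e"
    using spectrum_non_empty[OF A] unfolding spectrum_def eigenvalue_def by auto
  hence v: "v \<in> carrier_vec (Suc m)" "v \<noteq> 0\<^sub>v (Suc m)" and ev: "A *\<^sub>v v = e \<cdot>\<^sub>v v"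
    using A unfolding eigenvector_def by auto
  obtain W c where W: "unitary (Suc m) W" and col0: "col W 0 = c \<cdot>\<^sub>v v"
    using unitary_with_first_column[OF v] by blast
  note cW = unitaryD[OF W]
  define A' where "A' = mat_adjoint W * A * W"
  have A': "A' \<in> carrier_mat (Suc m) (Suc m)" using A cW unfolding A'_def by simp
  have hA': "mat_adjoint A' = A'"
    using hermitian_conj[OF Suc.prems cW(1)] unfolding A'_def hermitian_def by simp
  have AW: "col (A * W) 0 = e \<cdot>\<^sub>v col W 0"
  proof -
    have "col (A * W) 0 = A *\<^sub>v col W 0" by (rule col_mult2[OF A cW(1)]) simp
    also have "\<dots> = c \<cdot>\<^sub>v (A *\<^sub>v v)" unfolding col0 using A v by (simp add: mult_mat_vec)
    finally show ?thesis unfolding ev col0 by (simp add: smult_smult_assoc mult.commute)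
  qed
  have first: "A' $$ (i, 0) = (if i = 0 then e else 0)" if i: "i < Suc m" for i
  proof -
    have "A' $$ (i, 0) = row (mat_adjoint W) i \<bullet> col (A * W) 0"
      unfolding A'_def using A cW i by (subst assoc_square[of _ "Suc m"] mult_carrier_square[of _ "Suc m"]) auto
    also have "\<dots> = e * (mat_adjoint W * W) $$ (i, 0)"
      unfolding AW using cW(1,2) i by (auto simp: scalar_prod_def sum_distrib_left algebra_simps)
    finally show ?thesis unfolding cW(3) using i by simp
  qed
  have first': "A' $$ (0, i) = (if i = 0 then e else 0)" if i: "i < Suc m" for i
    using arg_cong[OF hA', of "\<lambda>M. M $$ (0, i)"] first[of i] first[of 0] A' i
      arg_cong[OF hA', of "\<lambda>M. M $$ (0, 0)"] by auto
  have real: "complex_of_real (Re e) = e"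
    using arg_cong[OF hA', of "\<lambda>M. M $$ (0, 0)"] first[of 0] A' by (auto simp: complex_eq_iff)
  define A3 where "A3 = mat m m (\<lambda>(i, j). A' $$ (Suc i, Suc j))"
  have block: "A' = direct_sum_mat (mat_diag 1 (\<lambda>_. complex_of_real (Re e))) A3"
    unfolding real direct_sum_mat_def using A' first first'
    by (intro eq_matI) (auto simp: A3_def mat_diag_def)
  have "hermitian m A3"
  proof -
    have "cnj (A' $$ (j, i)) = A' $$ (i, j)" if "i < Suc m" "j < Suc m" for i j
      using arg_cong[OF hA', of "\<lambda>M. M $$ (i, j)"] A' that by auto
    thus ?thesis unfolding hermitian_def A3_def by (auto intro!: eq_matI)
  qed
  then obtain U l where "spectral_decomp m A3 U l" using Suc.IH by blast
  moreover have "spectral_decomp 1 (mat_diag 1 (\<lambda>_. complex_of_real (Re e))) (1\<^sub>m 1) (\<lambda>_. Re e)"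
    unfolding spectral_decomp_def using unitary_one
      left_mult_one_mat[of "mat_diag 1 (\<lambda>_. complex_of_real (Re e))" 1 1]
      right_mult_one_mat[of "mat_diag 1 (\<lambda>_. complex_of_real (Re e))" 1 1] by auto
  ultimately obtain U' l' where "spectral_decomp (1 + m) A' U' l'"
    using spectral_decomp_direct_sum unfolding block by blast
  hence "spectral_decomp (Suc m) (W * A' * mat_adjoint W) (W * U') l'"
    using spectral_decomp_conj[OF W] by simp
  moreover have "W * A' * mat_adjoint W = A"
    unfolding A'_def using A cW unitary_cancel(2)[OF W]
    by (simp add: assoc_square[of _ "Suc m"] mult_carrier_square[of _ "Suc m"])
  ultimately show ?case by auto
qed

lemma spectral_decomp_eigenvalue:
  assumes "spectral_decomp d A U l" "i < d"
  shows "complex_of_real (l i) \<in> spectrum A"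
proof -
  let ?D = "mat_diag d (\<lambda>i. complex_of_real (l i))"
  have U: "unitary d U" and A: "A = U * ?D * mat_adjoint U"
    using assms unfolding spectral_decomp_def by auto
  note c = unitaryD[OF U]
  have cA: "A \<in> carrier_mat d d" unfolding A using c by (simp add: mult_carrier_square)
  have "A * U = U * ?D"
    unfolding A using c
    by (simp add: assoc_square[of _ d] mult_carrier_square[of _ d] right_mult_one_mat[of _ d d])
  hence "A *\<^sub>v col U i = col (U * ?D) i"
    using c cA assms(2) by (simp add: col_mult2[of _ d d, symmetric])
  also have "\<dots> = complex_of_real (l i) \<cdot>\<^sub>v col U i"
    unfolding mat_diag_mult_right[OF c(1)] using c assms(2) by (intro eq_vecI) auto
  finally have "A *\<^sub>v col U i = complex_of_real (l i) \<cdot>\<^sub>v col U i" .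
  moreover have "col U i \<noteq> 0\<^sub>v d"
  proof
    assume "col U i = 0\<^sub>v d"
    hence "(mat_adjoint U * U) $$ (i, i) = 0" using c(1,2) assms(2) by simp
    thus False using c(3) assms(2) by simp
  qed
  ultimately show ?thesis
    using c(1) cA assms(2) unfolding spectrum_def eigenvalue_def eigenvector_def
    by (auto intro!: exI[of _ "col U i"])
qed

section \<open>Averages over a unitary orbit\<close>

lemma finsum_mat_index:
  assumes "finite K" "\<And>k. k \<in> K \<Longrightarrow> F k \<in> carrier_mat d d"
  shows "finsum (module_mat TYPE(complex) d d) F K = mat d d (\<lambda>(i, j). \<Sum>k\<in>K. F k $$ (i, j))"
proof -
  interpret M: abelian_group "module_mat TYPE(complex) d d" by (rule abelian_group_mat)
  show ?thesis using assms
  proof (induction K rule: finite_induct)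
    case empty
    show ?case unfolding M.finsum_empty module_mat_simps by (intro eq_matI) auto
  next
    case (insert k K)
    have "F \<in> K \<rightarrow> carrier (module_mat TYPE(complex) d d)" "F k \<in> carrier (module_mat TYPE(complex) d d)"
      using insert.prems unfolding module_mat_simps by auto
    from M.finsum_insert[OF insert.hyps this] show ?case
      using insert by (auto simp: module_mat_simps intro!: eq_matI)
  qed
qed

lemma finsum_mat_conj:
  assumes "finite K" "\<And>k. k \<in> K \<Longrightarrow> F k \<in> carrier_mat d d"
    and V: "V \<in> carrier_mat d d" "V' \<in> carrier_mat d d"
  shows "finsum (module_mat TYPE(complex) d d) (\<lambda>k. V * F k * V') K
    = V * finsum (module_mat TYPE(complex) d d) F K * V'"
proof -
  interpret M: abelian_group "module_mat TYPE(complex) d d" by (rule abelian_group_mat)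
  show ?thesis using assms(1,2)
  proof (induction K rule: finite_induct)
    case empty
    show ?case unfolding M.finsum_empty module_mat_simps using V by simp
  next
    case (insert k K)
    let ?G = "\<lambda>k. V * F k * V'"
    have F: "F \<in> K \<rightarrow> carrier (module_mat TYPE(complex) d d)" "F k \<in> carrier (module_mat TYPE(complex) d d)"
      and G: "?G \<in> K \<rightarrow> carrier (module_mat TYPE(complex) d d)" "?G k \<in> carrier (module_mat TYPE(complex) d d)"
      using insert.prems V unfolding module_mat_simps by auto
    have s: "finsum (module_mat TYPE(complex) d d) F K \<in> carrier_mat d d"
      using M.finsum_closed[OF F(1)] unfolding module_mat_simps .
    have Fk: "F k \<in> carrier_mat d d" using insert.prems by auto
    show ?case
      unfolding M.finsum_insert[OF insert.hyps F] M.finsum_insert[OF insert.hyps G]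
      using insert V s Fk
      by (simp add: module_mat_simps mult_add_distrib_mat[of _ d d _ d] add_mult_distrib_mat[of _ d d _ _ d])
  qed
qed

lemma sum_roots_of_unity_pow:
  assumes "z ^ d = 1" "z \<noteq> (1 :: complex)"
  shows "(\<Sum>k = 1..d. z ^ k) = 0"
proof -
  have "(\<Sum>k = 1..d. z ^ k) = (\<Sum>k<d. z * z ^ k)"
    by (rule sum.reindex_bij_witness[of _ Suc "\<lambda>k. k - 1"]) (auto simp flip: power_Suc)
  also have "\<dots> = z * (\<Sum>k<d. z ^ k)" by (simp add: sum_distrib_left)
  also have "\<dots> = 0" using assms by (simp add: geometric_sum)
  finally show ?thesis .
qed

text \<open>
  Conjugation by the phases multiplies entry \<open>(i, j)\<close> by the \<open>k\<close>-th power of the root of unity with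
  index \<open>i - j\<close>. For \<open>i \<noteq> j\<close> this root differs from 1, and its powers cancel in the sum.
\<close>

lemma finsum_phase_conj:
  fixes K :: "complex mat"
  assumes K: "K \<in> carrier_mat d d"
  defines "D k \<equiv> mat_diag d (\<lambda>i. cis (2 * pi * real (i * k) / real d))"
  shows "finsum (module_mat TYPE(complex) d d) (\<lambda>k. D k * K * mat_adjoint (D k)) {1..d}
    = mat_diag d (\<lambda>i. of_nat d * K $$ (i, i))"
proof -
  have D: "D k \<in> carrier_mat d d" for k unfolding D_def by simp
  have entry: "(D k * K * mat_adjoint (D k)) $$ (i, j) =
      K $$ (i, j) * (cis (2 * pi * (real i - real j) / real d)) ^ k" if ij: "i < d" "j < d" for i j k
  proof -
    have DK: "D k * K \<in> carrier_mat d d" using D K by (rule mult_carrier_mat)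
    have "(D k * K * mat_adjoint (D k)) $$ (i, j) =
        cis (2 * pi * real (i * k) / real d) * K $$ (i, j) * cnj (cis (2 * pi * real (j * k) / real d))"
      unfolding D_def mat_adjoint_mat_diag mat_diag_mult_left[OF K]
      by (subst mat_diag_mult_right[of _ d]) (use ij in auto)
    also have "\<dots> = K $$ (i, j) * (cis (2 * pi * real (i * k) / real d) * cis (- (2 * pi * real (j * k) / real d)))"
      by (simp add: cis_cnj)
    also have "cis (2 * pi * real (i * k) / real d) * cis (- (2 * pi * real (j * k) / real d))
        = cis (real k * (2 * pi * (real i - real j) / real d))"
      unfolding cis_mult by (simp add: algebra_simps diff_divide_distrib)
    finally show ?thesis by (simp only: Complex.DeMoivre)
  qed
  have sum: "(\<Sum>k = 1..d. (cis (2 * pi * (real i - real j) / real d)) ^ k) = (if i = j then of_nat d else 0)"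
    if ij: "i < d" "j < d" for i j
  proof (cases "i = j")
    case False
    let ?z = "cis (2 * pi * (real i - real j) / real d)"
    have "?z ^ d = cis (real d * (2 * pi * (real i - real j) / real d))"
      by (simp only: Complex.DeMoivre)
    also have "real d * (2 * pi * (real i - real j) / real d) = 2 * pi * of_int (int i - int j)"
      using ij by simp
    finally have "?z ^ d = 1" using cis_multiple_2pi by (metis Ints_of_int)
    moreover have "?z \<noteq> 1"
    proof
      assume "?z = 1"
      hence "cos (2 * pi * (real i - real j) / real d) = 1"
        by (metis cis.sel(1) one_complex.sel(1))
      then obtain m :: int where "2 * pi * (real i - real j) / real d = of_int m * 2 * pi"
        by (auto simp: cos_one_2pi_int)
      hence "2 * pi * ((real i - real j) / real d) = 2 * pi * of_int m" by (simp add: mult_ac)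
      hence "(real i - real j) / real d = of_int m"
        unfolding mult_cancel_left using pi_neq_zero by simp
      hence "2 * pi * ((real i - real j) / real d) = 2 * pi * of_int m" by (simp add: mult_ac)
      hence "(real i - real j) / real d = of_int m"
        unfolding mult_cancel_left using pi_neq_zero by simp
      hence "2 * pi * ((real i - real j) / real d) = 2 * pi * of_int m" by (simp add: mult_ac)
      hence "(real i - real j) / real d = of_int m"
        unfolding mult_cancel_left using pi_neq_zero by simp
      hence "2 * pi * ((real i - real j) / real d) = 2 * pi * of_int m" by (simp add: mult_ac)
      hence "(real i - real j) / real d = of_int m"
        unfolding mult_cancel_left using pi_neq_zero by simp
      hence "2 * pi * ((real i - real j) / real d) = 2 * pi * of_int m" by (simp add: mult_ac)
      hence "(real i - real j) / real d = of_int m"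
        unfolding mult_cancel_left using pi_neq_zero by simp
      hence "2 * pi * ((real i - real j) / real d) = 2 * pi * of_int m" by (simp add: mult_ac)
      hence "(real i - real j) / real d = of_int m"
        unfolding mult_cancel_left using pi_neq_zero by simp
      hence "2 * pi * ((real i - real j) / real d) = 2 * pi * of_int m" by (simp add: mult_ac)
      hence "(real i - real j) / real d = of_int m"
        unfolding mult_cancel_left using pi_neq_zero by simp
      hence "real i - real j = of_int m * real d" using ij by (simp add: field_simps)
      hence "of_int (int i - int j) = (of_int (m * int d) :: real)" by simp
      hence m: "int i - int j = m * int d" using of_int_eq_iff by blast
      hence "int d dvd int i - int j" by simp
      moreover have "\<bar>int i - int j\<bar> < int d" "int i - int j \<noteq> 0" using ij False by auto
      ultimately show False using dvd_imp_le_int[of "int i - int j" "int d"] by linarith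
    qed
    ultimately show ?thesis unfolding if_not_P[OF False] by (rule sum_roots_of_unity_pow)
  qed simp
  show ?thesis
  proof (subst finsum_mat_index)
    show "D k * K * mat_adjoint (D k) \<in> carrier_mat d d" for k
      using D mat_adjoint_carrier[OF D] K by (simp add: mult_carrier_square)
    show "mat d d (\<lambda>(i, j). \<Sum>k = 1..d. (D k * K * mat_adjoint (D k)) $$ (i, j))
        = mat_diag d (\<lambda>i. of_nat d * K $$ (i, i))"
    proof (rule eq_matI)
      fix i j assume "i < dim_row (mat_diag d (\<lambda>i. of_nat d * K $$ (i, i)))"
        "j < dim_col (mat_diag d (\<lambda>i. of_nat d * K $$ (i, i)))"
      hence ij: "i < d" "j < d" by (auto simp: mat_diag_def)
      have "(\<Sum>k = 1..d. (D k * K * mat_adjoint (D k)) $$ (i, j)) =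
          K $$ (i, j) * (if i = j then of_nat d else 0)"
        unfolding entry[OF ij] sum_distrib_left[symmetric] sum[OF ij] ..
      thus "mat d d (\<lambda>(i, j). \<Sum>k = 1..d. (D k * K * mat_adjoint (D k)) $$ (i, j)) $$ (i, j)
          = mat_diag d (\<lambda>i. of_nat d * K $$ (i, i)) $$ (i, j)"
        using ij by (simp add: mat_diag_def)
    qed (auto simp: mat_diag_def)
  qed simp
qed

text \<open>
  In the coordinates \<open>w = V\<^sup>*v\<close>, the quadratic form of the difference is the sum of
  \<open>(m i - l i) |w i|\<^sup>2\<close>.
\<close>

lemma loewner_le_mat_diag_conj:
  assumes V: "unitary d V" and le: "\<And>i. i < d \<Longrightarrow> l i \<le> m i"
  shows "loewner_le d (V * mat_diag d (\<lambda>i. complex_of_real (l i)) * mat_adjoint V)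
    (V * mat_diag d (\<lambda>i. complex_of_real (m i)) * mat_adjoint V)"
proof -
  let ?D = "\<lambda>l. mat_diag d (\<lambda>i. complex_of_real (l i))"
  note c = unitaryD[OF V]
  have herm: "hermitian d (V * ?D l * mat_adjoint V)" for l
    by (rule hermitian_spectral_decomp[of _ _ V l]) (use V in \<open>simp add: spectral_decomp_def\<close>)
  have D: "?D l \<in> carrier_mat d d" for l by simp
  have "?D (\<lambda>i. m i - l i) = ?D m - ?D l"
    by (intro eq_matI) (auto simp: mat_diag_def)
  hence "V * ?D (\<lambda>i. m i - l i) * mat_adjoint V = V * (?D m - ?D l) * mat_adjoint V" by simp
  also have "\<dots> = V * ?D m * mat_adjoint V - V * ?D l * mat_adjoint V"
    using c mult_minus_distrib_mat[OF c(1) D D]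
      minus_mult_distrib_mat[OF mult_carrier_mat[OF c(1) D] mult_carrier_mat[OF c(1) D] c(2)] by simp
  finally have eq: "V * ?D m * mat_adjoint V - V * ?D l * mat_adjoint V
      = V * ?D (\<lambda>i. m i - l i) * mat_adjoint V" by simp
  have quad: "(?D g *\<^sub>v w) \<bullet>c w = (\<Sum>i<d. complex_of_real (g i) * w $ i * cnj (w $ i))"
    if w: "w \<in> carrier_vec d" for w g
  proof -
    have "(?D g *\<^sub>v w) $ i = complex_of_real (g i) * w $ i" if "i < d" for i
    proof -
      have "(?D g *\<^sub>v w) $ i = (\<Sum>j = 0..<d. if i = j then complex_of_real (g j) * w $ j else 0)"
        using that w unfolding mat_diag_def
        by (auto simp: scalar_prod_def simp del: sum.delta sum.delta' intro!: sum.cong)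
      thus ?thesis using that by simp
    qed
    thus ?thesis using w unfolding scalar_prod_def
      by (auto simp: lessThan_atLeast0 simp del: index_mult_mat_vec intro!: sum.cong)
  qed
  have "0 \<le> Re ((V * ?D (\<lambda>i. m i - l i) * mat_adjoint V *\<^sub>v v) \<bullet>c v)" if v: "v \<in> carrier_vec d" for v
  proof -
    let ?w = "mat_adjoint V *\<^sub>v v"
    have w: "?w \<in> carrier_vec d" using c v by simp
    have Dw: "?D (\<lambda>i. m i - l i) *\<^sub>v ?w \<in> carrier_vec d"
      using D w by (rule mult_mat_vec_carrier)
    have "V * ?D (\<lambda>i. m i - l i) * mat_adjoint V *\<^sub>v v = V *\<^sub>v (?D (\<lambda>i. m i - l i) *\<^sub>v ?w)"
      using c D v w by (simp add: assoc_mult_mat_vec[of _ d d _ d] mult_carrier_square)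
    moreover have "(V *\<^sub>v u) \<bullet>c v = u \<bullet>c ?w" if u: "u \<in> carrier_vec d" for u
    proof -
      have "(V *\<^sub>v u) \<bullet>c v = (\<Sum>i<d. \<Sum>j<d. V $$ (i, j) * u $ j * cnj (v $ i))"
        using c u v by (auto simp: scalar_prod_def lessThan_atLeast0 sum_distrib_right intro!: sum.cong)
      also have "\<dots> = (\<Sum>j<d. \<Sum>i<d. V $$ (i, j) * u $ j * cnj (v $ i))" by (rule sum.swap)
      also have "\<dots> = u \<bullet>c ?w"
        using c u v by (auto simp: scalar_prod_def lessThan_atLeast0 sum_distrib_left mult_ac intro!: sum.cong)
      finally show ?thesis .
    qed
    ultimately have "(V * ?D (\<lambda>i. m i - l i) * mat_adjoint V *\<^sub>v v) \<bullet>c v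
        = (?D (\<lambda>i. m i - l i) *\<^sub>v ?w) \<bullet>c ?w" using Dw by simp
    also have "\<dots> = (\<Sum>i<d. complex_of_real (m i - l i) * ?w $ i * cnj (?w $ i))"
      by (rule quad[OF w])
    also have "\<dots> = complex_of_real (\<Sum>i<d. (m i - l i) * (cmod (?w $ i))\<^sup>2)"
      by (simp add: complex_norm_square mult.assoc del: of_real_power)
    finally have "Re ((V * ?D (\<lambda>i. m i - l i) * mat_adjoint V *\<^sub>v v) \<bullet>c v) = (\<Sum>i<d. (m i - l i) * (cmod (?w $ i))\<^sup>2)"
      by simp
    thus ?thesis using le by (auto intro!: sum_nonneg)
  qed
  thus ?thesis unfolding loewner_le_def psd_def eq using herm[of l] herm[of m] herm[of "\<lambda>i. m i - l i"]
    by auto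
qed

text \<open>
  The unitaries are \<open>V D\<^sub>k W Q\<^sup>*\<close>: here \<open>Q\<^sup>*\<close> diagonalises \<open>T\<close>, Horn's theorem gives \<open>W\<close> which moves \<open>P s\<close>
  onto the diagonal, averaging over the phases \<open>D\<^sub>k\<close> removes everything off the diagonal, and \<open>V\<close>
  places the result in the eigenbasis of \<open>S\<close>.
\<close>

lemma loewner_le_average_of_unitary_orbit:
  fixes P :: "nat \<Rightarrow> nat \<Rightarrow> real"
  assumes d: "d > 0" and S: "spectral_decomp d S V l" and T: "spectral_decomp d T Q s"
    and nonneg: "\<And>i j. i < d \<Longrightarrow> j < d \<Longrightarrow> 0 \<le> P i j"
    and row: "\<And>i. i < d \<Longrightarrow> (\<Sum>j<d. P i j) = 1"
    and col: "\<And>j. j < d \<Longrightarrow> (\<Sum>i<d. P i j) = 1"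
    and le: "\<And>i. i < d \<Longrightarrow> l i \<le> (\<Sum>j<d. P i j * s j)"
  shows "\<exists>U. (\<forall>k\<in>{1..d}. unitary d (U k)) \<and>
    loewner_le d S (complex_of_real (1 / real d) \<cdot>\<^sub>m
      finsum (module_mat TYPE(complex) d d) (\<lambda>k. U k * T * mat_adjoint (U k)) {1..d})"
proof -
  define t where "t i = (\<Sum>j<d. P i j * s j)" for i
  have "hinge_majorizes {..<d} s {..<d} t"
    unfolding t_def by (rule hinge_majorizes_doubly_stochastic) (use nonneg row col in auto)
  from hinge_majorizes_imp_orthostochastic[OF _ _ _ this] obtain R :: "nat \<Rightarrow> nat \<Rightarrow> real" where
    R1: "\<And>i i'. i < d \<Longrightarrow> i' < d \<Longrightarrow> (\<Sum>j<d. R i j * R i' j) = (if i = i' then 1 else 0)"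
    and R2: "\<And>i. i < d \<Longrightarrow> (\<Sum>j<d. (R i j)\<^sup>2 * s j) = t i" by auto
  let ?Ds = "mat_diag d (\<lambda>i. complex_of_real (s i))"
  let ?Dt = "mat_diag d (\<lambda>i. complex_of_real (t i))"
  have Ds: "?Ds \<in> carrier_mat d d" and Dt: "?Dt \<in> carrier_mat d d" by auto
  have V: "unitary d V" and S_eq: "S = V * mat_diag d (\<lambda>i. complex_of_real (l i)) * mat_adjoint V"
    using S unfolding spectral_decomp_def by auto
  have Q: "unitary d Q" and T_eq: "T = Q * ?Ds * mat_adjoint Q"
    using T unfolding spectral_decomp_def by auto
  define W where "W = mat d d (\<lambda>(i, j). complex_of_real (R i j))"
  have W: "W \<in> carrier_mat d d" unfolding W_def by simp
  have "W * mat_adjoint W = 1\<^sub>m d"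
  proof (rule eq_matI)
    fix i j assume "i < dim_row (1\<^sub>m d :: complex mat)" "j < dim_col (1\<^sub>m d :: complex mat)"
    hence ij: "i < d" "j < d" by auto
    have "(W * mat_adjoint W) $$ (i, j) = complex_of_real (\<Sum>k<d. R i k * R j k)"
      using W ij by (auto simp: scalar_prod_def lessThan_atLeast0 W_def intro!: sum.cong)
    thus "(W * mat_adjoint W) $$ (i, j) = 1\<^sub>m d $$ (i, j)" using R1[OF ij] ij by simp
  qed (use W in auto)
  hence W: "unitary d W"
    using unitary_adjoint[OF unitaryI[of "mat_adjoint W" d]] W mat_adjoint_carrier[OF W] by simp
  note c = unitaryD[OF V] unitaryD[OF Q] unitaryD[OF W]
  define K where "K = W * ?Ds * mat_adjoint W"
  have K: "K \<in> carrier_mat d d" unfolding K_def using c Ds by (simp add: mult_carrier_square)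
  have Kii: "K $$ (i, i) = complex_of_real (t i)" if "i < d" for i
    unfolding K_def conj_mat_diag_diag_entry[OF c(9) that] using R2[OF that] that
    by (simp add: W_def)
  define D where "D k = mat_diag d (\<lambda>i. cis (2 * pi * real (i * k) / real d))" for k
  have D: "unitary d (D k)" for k unfolding D_def by (rule unitary_mat_diag) simp
  define U where "U k = V * (D k * (W * mat_adjoint Q))" for k
  have U: "unitary d (U k)" for k
    unfolding U_def by (intro unitary_mult V D W unitary_adjoint Q)
  have UT: "U k * T * mat_adjoint (U k) = V * (D k * K * mat_adjoint (D k)) * mat_adjoint V" for k
    unfolding U_def T_eq K_def using c unitaryD[OF D] Ds unitary_cancel(1)[OF Q]
    by (simp add: mat_adjoint_mult[of _ d d _ d] assoc_square[of _ d] mult_carrier_square[of _ d])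
  have DKD: "D k * K * mat_adjoint (D k) \<in> carrier_mat d d" for k
    using unitaryD[OF D] K by (simp add: mult_carrier_square)
  have "finsum (module_mat TYPE(complex) d d) (\<lambda>k. U k * T * mat_adjoint (U k)) {1..d}
      = V * mat_diag d (\<lambda>i. of_nat d * K $$ (i, i)) * mat_adjoint V"
    unfolding UT finsum_phase_conj[OF K, folded D_def, symmetric]
    by (rule finsum_mat_conj) (use DKD c in auto)
  also have "mat_diag d (\<lambda>i. of_nat d * K $$ (i, i)) = of_nat d \<cdot>\<^sub>m ?Dt"
    using Kii by (intro eq_matI) (auto simp: mat_diag_def)
  also have "V * (of_nat d \<cdot>\<^sub>m ?Dt) * mat_adjoint V = of_nat d \<cdot>\<^sub>m (V * ?Dt * mat_adjoint V)"
    using c Dt by (simp add: mult_smult_distrib[of _ d d _ d] mult_smult_assoc_mat[of _ d d _ d] mult_carrier_square)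
  finally have "complex_of_real (1 / real d) \<cdot>\<^sub>m
      finsum (module_mat TYPE(complex) d d) (\<lambda>k. U k * T * mat_adjoint (U k)) {1..d} = V * ?Dt * mat_adjoint V"
    using d by (auto intro!: eq_matI)
  moreover have "loewner_le d S (V * ?Dt * mat_adjoint V)"
    unfolding S_eq by (rule loewner_le_mat_diag_conj[OF V]) (use le in \<open>simp add: t_def\<close>)
  ultimately show ?thesis using U by (intro exI[of _ U]) simp
qed

section \<open>The doubly stochastic matrix of a compression\<close>

lemma sum_lessThan_add:
  fixes g :: "nat \<Rightarrow> 'a :: comm_monoid_add"
  shows "(\<Sum>j<n+m. g j) = (\<Sum>j<n. g j) + (\<Sum>j<m. g (n + j))"
  by (induction m) (simp_all add: add.assoc)

text \<open>
  The matrix \<open>S\<close> is \<open>X\<^sup>*\<close> written between two orthonormal bases. These identities translate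
  statements about \<open>X\<close> into statements about its entries in those bases.
\<close>

lemma unitary_conj_adjoint:
  assumes "unitary d L" "unitary d R" "X \<in> carrier_mat d d" "M \<in> carrier_mat d d"
    and "S = mat_adjoint L * mat_adjoint X * R"
  shows "S \<in> carrier_mat d d"
    and "S * M * mat_adjoint S
      = mat_adjoint L * (mat_adjoint X * (R * M * mat_adjoint R) * X) * L"
    and "S * mat_adjoint S = mat_adjoint L * (mat_adjoint X * X) * L"
    and "mat_adjoint S * S = mat_adjoint R * (X * mat_adjoint X) * R"
proof -
  note c = unitaryD(1,2)[OF assms(1)] unitaryD(1,2)[OF assms(2)]
    assms(3) mat_adjoint_carrier[OF assms(3)] assms(4)
  have adj: "mat_adjoint S = mat_adjoint R * (X * L)"
    unfolding assms(5) using c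
    by (simp add: mat_adjoint_mult[of _ d d _ d] assoc_square[of _ d] mult_carrier_square[of _ d]
        del: mult_carrier_mat)
  note sq = assoc_square[of _ d] mult_carrier_square[of _ d]
  show "S \<in> carrier_mat d d"
    unfolding assms(5) using c by (simp add: sq del: mult_carrier_mat)
  show "S * M * mat_adjoint S
      = mat_adjoint L * (mat_adjoint X * (R * M * mat_adjoint R) * X) * L"
    unfolding adj unfolding assms(5) using c by (simp add: sq del: mult_carrier_mat)
  show "S * mat_adjoint S = mat_adjoint L * (mat_adjoint X * X) * L"
    unfolding adj unfolding assms(5) using c
    by (simp add: sq unitary_cancel[OF assms(2)] del: mult_carrier_mat)
  show "mat_adjoint S * S = mat_adjoint R * (X * mat_adjoint X) * R"
    unfolding adj unfolding assms(5) using c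
    by (simp add: sq unitary_cancel[OF assms(1)] del: mult_carrier_mat)
qed

lemma unitary_conj_add:
  assumes "unitary d U" "E \<in> carrier_mat d d" "F \<in> carrier_mat d d"
  shows "mat_adjoint U * E * U + mat_adjoint U * F * U = mat_adjoint U * (E + F) * U"
  using assms unitaryD[OF assms(1)]
  by (simp add: mult_add_distrib_mat[of _ d d _ d] add_mult_distrib_mat[of _ d d _ _ d] mult_carrier_square)

text \<open>
  Conjugating the compression by its eigenbasis \<open>U\<close> puts its eigenvalues on the diagonal. A diagonal entry of a conjugated
  diagonal matrix is a combination of its diagonal with squared moduli as coefficients.
\<close>

lemma eigenvalues_compression:
  assumes A: "spectral_decomp d A UA a" and B: "spectral_decomp d B UB b"
    and X: "X \<in> carrier_mat d d" and Y: "Y \<in> carrier_mat d d"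
    and M: "spectral_decomp d (mat_adjoint X * A * X + mat_adjoint Y * B * Y) U m"
    and i: "i < d"
  shows "m i = (\<Sum>j<d. (cmod ((mat_adjoint U * mat_adjoint X * UA) $$ (i, j)))\<^sup>2 * a j)
      + (\<Sum>j<d. (cmod ((mat_adjoint U * mat_adjoint Y * UB) $$ (i, j)))\<^sup>2 * b j)"
proof -
  let ?D = "\<lambda>l. mat_diag d (\<lambda>i. complex_of_real (l i))"
  define S where "S = mat_adjoint U * mat_adjoint X * UA"
  define R where "R = mat_adjoint U * mat_adjoint Y * UB"
  have uA: "unitary d UA" and uB: "unitary d UB" and uU: "unitary d U"
    and A_eq: "A = UA * ?D a * mat_adjoint UA" and B_eq: "B = UB * ?D b * mat_adjoint UB"
    and M_eq: "mat_adjoint X * A * X + mat_adjoint Y * B * Y = U * ?D m * mat_adjoint U"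
    using A B M unfolding spectral_decomp_def by auto
  have D: "?D l \<in> carrier_mat d d" for l by simp
  note S = unitary_conj_adjoint[OF uU uA X D S_def] and R = unitary_conj_adjoint[OF uU uB Y D R_def]
  have cA: "A \<in> carrier_mat d d" and cB: "B \<in> carrier_mat d d"
    using hermitian_spectral_decomp A B unfolding hermitian_def by auto
  have cS: "S * ?D a * mat_adjoint S \<in> carrier_mat d d" and cR: "R * ?D b * mat_adjoint R \<in> carrier_mat d d"
    using S(1) R(1) mat_adjoint_carrier by (auto intro!: mult_carrier_square)
  have "S * ?D a * mat_adjoint S + R * ?D b * mat_adjoint R
      = mat_adjoint U * (mat_adjoint X * A * X + mat_adjoint Y * B * Y) * U"
    unfolding S(2)[of a] R(2)[of b] A_eq[symmetric] B_eq[symmetric]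
    by (rule unitary_conj_add[OF uU]) (intro mult_carrier_square mat_adjoint_carrier X Y cA cB)+
  also have "\<dots> = ?D m"
    unfolding M_eq using unitaryD[OF uU] unitary_cancel[OF uU] D
    by (simp add: assoc_square[of _ d] mult_carrier_square[of _ d] right_mult_one_mat[of _ d d]
        del: mult_carrier_mat)
  finally have eq: "S * ?D a * mat_adjoint S + R * ?D b * mat_adjoint R = ?D m" .
  have "complex_of_real (m i) = ?D m $$ (i, i)" using i by (simp add: mat_diag_def)
  also have "\<dots> = (S * ?D a * mat_adjoint S) $$ (i, i) + (R * ?D b * mat_adjoint R) $$ (i, i)"
    unfolding eq[symmetric] by (rule index_add_mat(1)) (use cR i in auto)
  also have "\<dots> = complex_of_real ((\<Sum>j<d. (cmod (S $$ (i, j)))\<^sup>2 * a j) + (\<Sum>j<d. (cmod (R $$ (i, j)))\<^sup>2 * b j))"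
    unfolding conj_mat_diag_diag_entry[OF S(1) i] conj_mat_diag_diag_entry[OF R(1) i] by simp
  finally show ?thesis unfolding S_def R_def of_real_eq_iff .
qed

text \<open>
  The sum of the squared moduli in a row of a matrix \<open>S\<close> is a diagonal entry of \<open>SS\<^sup>*\<close>, so the isometry
  relation, conjugated by \<open>U\<close>, gives the total weight of row \<open>i\<close>.
\<close>

lemma isometry_row_sum:
  assumes UA: "unitary d UA" and UB: "unitary d UB" and U: "unitary d U"
    and X: "X \<in> carrier_mat d d" and Y: "Y \<in> carrier_mat d d"
    and iso: "mat_adjoint X * X + mat_adjoint Y * Y = 1\<^sub>m d" and i: "i < d"
  shows "(\<Sum>j<d. (cmod ((mat_adjoint U * mat_adjoint X * UA) $$ (i, j)))\<^sup>2)
      + (\<Sum>j<d. (cmod ((mat_adjoint U * mat_adjoint Y * UB) $$ (i, j)))\<^sup>2) = 1"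
proof -
  define S where "S = mat_adjoint U * mat_adjoint X * UA"
  define R where "R = mat_adjoint U * mat_adjoint Y * UB"
  note S = unitary_conj_adjoint[OF U UA X one_carrier_mat S_def]
    and R = unitary_conj_adjoint[OF U UB Y one_carrier_mat R_def]
  have "S * mat_adjoint S + R * mat_adjoint R = mat_adjoint U * (mat_adjoint X * X + mat_adjoint Y * Y) * U"
    unfolding S(3) R(3)
    by (rule unitary_conj_add[OF U]) (intro mult_carrier_square mat_adjoint_carrier X Y)+
  also have "\<dots> = 1\<^sub>m d" unfolding iso using unitaryD[OF U] by simp
  finally have eq: "S * mat_adjoint S + R * mat_adjoint R = 1\<^sub>m d" .
  have "complex_of_real 1 = (1\<^sub>m d :: complex mat) $$ (i, i)" using i by simp
  also have "\<dots> = (S * mat_adjoint S) $$ (i, i) + (R * mat_adjoint R) $$ (i, i)"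
    unfolding eq[symmetric] by (rule index_add_mat(1)) (use R(1) i in auto)
  also have "\<dots> = complex_of_real ((\<Sum>j<d. (cmod (S $$ (i, j)))\<^sup>2) + (\<Sum>j<d. (cmod (R $$ (i, j)))\<^sup>2))"
    unfolding mult_adjoint_diag_entry[OF S(1) i] mult_adjoint_diag_entry[OF R(1) i] by simp
  finally show ?thesis unfolding S_def R_def of_real_eq_iff by simp
qed

text \<open>
  The same computation for columns, with \<open>S\<^sup>*S\<close> in place of \<open>SS\<^sup>*\<close>. A column belongs to one vector of
  the basis \<open>UA\<close> and meets both compressions; their eigenbases \<open>U\<close> and \<open>V\<close> may differ because each
  cancels in its own product.
\<close>

lemma coisometry_column_sum:
  assumes UA: "unitary d UA" and U: "unitary d U" and V: "unitary d V"
    and X: "X \<in> carrier_mat d d" and Y: "Y \<in> carrier_mat d d"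
    and coiso: "X * mat_adjoint X + Y * mat_adjoint Y = 1\<^sub>m d" and j: "j < d"
  shows "(\<Sum>i<d. (cmod ((mat_adjoint U * mat_adjoint X * UA) $$ (i, j)))\<^sup>2)
      + (\<Sum>i<d. (cmod ((mat_adjoint V * mat_adjoint Y * UA) $$ (i, j)))\<^sup>2) = 1"
proof -
  define S where "S = mat_adjoint U * mat_adjoint X * UA"
  define R where "R = mat_adjoint V * mat_adjoint Y * UA"
  note S = unitary_conj_adjoint[OF U UA X one_carrier_mat S_def]
    and R = unitary_conj_adjoint[OF V UA Y one_carrier_mat R_def]
  have "mat_adjoint S * S + mat_adjoint R * R = mat_adjoint UA * (X * mat_adjoint X + Y * mat_adjoint Y) * UA"
    unfolding S(4) R(4)
    by (rule unitary_conj_add[OF UA]) (intro mult_carrier_square mat_adjoint_carrier X Y)+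
  also have "\<dots> = 1\<^sub>m d" unfolding coiso using unitaryD[OF UA] by simp
  finally have eq: "mat_adjoint S * S + mat_adjoint R * R = 1\<^sub>m d" .
  have "complex_of_real 1 = (1\<^sub>m d :: complex mat) $$ (j, j)" using j by simp
  also have "\<dots> = (mat_adjoint S * S) $$ (j, j) + (mat_adjoint R * R) $$ (j, j)"
    unfolding eq[symmetric] by (rule index_add_mat(1)) (use R(1) j in auto)
  also have "\<dots> = complex_of_real ((\<Sum>i<d. (cmod (S $$ (i, j)))\<^sup>2) + (\<Sum>i<d. (cmod (R $$ (i, j)))\<^sup>2))"
    unfolding adjoint_mult_diag_entry[OF S(1) j] adjoint_mult_diag_entry[OF R(1) j] by simp
  finally show ?thesis unfolding S_def R_def of_real_eq_iff by simp
qed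

lemma spectral_decomp_fun_calc:
  assumes "spectral_decomp d Z U l"
  shows "spectral_decomp d (fun_calc f Z) U (\<lambda>i. f (l i))"
  using assms fun_calc_eqI[OF assms, of f] unfolding spectral_decomp_def by simp

theorem corollary3p4:
  fixes n :: nat and A B X Y :: "complex mat" and J :: "real set" and f :: "real \<Rightarrow> real"
  assumes "n \<ge> 1"
    and "hermitian n A" and "hermitian n B"
    and "is_interval J" and "convex_on J f"
    and "spectrum A \<subseteq> complex_of_real ` J" and "spectrum B \<subseteq> complex_of_real ` J"
    and "X \<in> carrier_mat n n" and "Y \<in> carrier_mat n n"
    and "mat_adjoint X * X + mat_adjoint Y * Y = 1\<^sub>m n"
    and "X * mat_adjoint X + Y * mat_adjoint Y = 1\<^sub>m n"
  shows "\<exists>U :: nat \<Rightarrow> complex mat. (\<forall>k \<in> {1..2*n}. unitary (2*n) (U k)) \<and>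
    loewner_le (2*n)
      (direct_sum_mat
        (fun_calc f (mat_adjoint X * A * X + mat_adjoint Y * B * Y))
        (fun_calc f (mat_adjoint Y * A * Y + mat_adjoint X * B * X)))
      (complex_of_real (1 / (2 * real n)) \<cdot>\<^sub>m
        finsum (module_mat TYPE(complex) (2*n) (2*n))
          (\<lambda>k. U k * fun_calc f (direct_sum_mat A B) * mat_adjoint (U k)) {1..2*n})"
proof -
  note X = assms(8) and Y = assms(9) and iso = assms(10) and coiso = assms(11)
  let ?M = "mat_adjoint X * A * X + mat_adjoint Y * B * Y"
  let ?N = "mat_adjoint Y * A * Y + mat_adjoint X * B * X"
  have "hermitian n ?M" "hermitian n ?N"
    using assms(2,3) X Y by (auto intro!: hermitian_add hermitian_conj)
  then obtain UA a UB b VM m VN k where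
    A: "spectral_decomp n A UA a" and B: "spectral_decomp n B UB b"
    and M: "spectral_decomp n ?M VM m" and N: "spectral_decomp n ?N VN k"
    using spectral_decomp_exists assms(2,3) by meson
  have UA: "unitary n UA" and UB: "unitary n UB" and VM: "unitary n VM" and VN: "unitary n VN"
    using A B M N unfolding spectral_decomp_def by auto
  have iso_swap: "mat_adjoint Y * Y + mat_adjoint X * X = 1\<^sub>m n"
    and coiso_swap: "Y * mat_adjoint Y + X * mat_adjoint X = 1\<^sub>m n"
    using iso coiso X Y mat_adjoint_carrier[OF X] mat_adjoint_carrier[OF Y]
    by (metis comm_add_mat mult_carrier_mat)+
  define SMA where "SMA = mat_adjoint VM * mat_adjoint X * UA"
  define SMB where "SMB = mat_adjoint VM * mat_adjoint Y * UB"
  define SNA where "SNA = mat_adjoint VN * mat_adjoint Y * UA"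
  define SNB where "SNB = mat_adjoint VN * mat_adjoint X * UB"
  \<comment> \<open>Row \<open>i\<close> belongs to the \<open>i\<close>-th eigenvector of \<open>M \<oplus> N\<close>, column \<open>j\<close> to the \<open>j\<close>-th of \<open>A \<oplus> B\<close>. In the
     rows of \<open>N\<close> the matrices \<open>X\<close> and \<open>Y\<close> are exchanged.\<close>
  define P where "P i j = (cmod (if i < n then if j < n then SMA $$ (i, j) else SMB $$ (i, j - n)
    else if j < n then SNA $$ (i - n, j) else SNB $$ (i - n, j - n)))\<^sup>2" for i j
  define ab where "ab i = (if i < n then a i else b (i - n))" for i
  define mk where "mk i = (if i < n then m i else k (i - n))" for i
  have two: "2 * n = n + n" by simp
  have nonneg: "0 \<le> P i j" for i j unfolding P_def by simp
  have row: "(\<Sum>j<2*n. P i j) = 1" if "i < 2*n" for i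
  proof (cases "i < n")
    case True
    thus ?thesis using isometry_row_sum[OF UA UB VM X Y iso True]
      unfolding two sum_lessThan_add P_def SMA_def SMB_def by simp
  next
    case False
    hence "i - n < n" using that by simp
    thus ?thesis using isometry_row_sum[OF UA UB VN Y X iso_swap, of "i - n"] False
      unfolding two sum_lessThan_add P_def SNA_def SNB_def by simp
  qed
  have col: "(\<Sum>i<2*n. P i j) = 1" if "j < 2*n" for j
  proof (cases "j < n")
    case True
    thus ?thesis using coisometry_column_sum[OF UA VM VN X Y coiso True]
      unfolding two sum_lessThan_add P_def SMA_def SNA_def by simp
  next
    case False
    hence "j - n < n" using that by simp
    thus ?thesis using coisometry_column_sum[OF UB VM VN Y X coiso_swap, of "j - n"] False
      unfolding two sum_lessThan_add P_def SMB_def SNB_def by simp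
  qed
  have mk: "mk i = (\<Sum>j<2*n. P i j * ab j)" if "i < 2*n" for i
  proof (cases "i < n")
    case True
    thus ?thesis using eigenvalues_compression[OF A B X Y M True]
      unfolding two sum_lessThan_add P_def SMA_def SMB_def mk_def ab_def by simp
  next
    case False
    hence "i - n < n" using that by simp
    thus ?thesis using eigenvalues_compression[OF A B Y X N, of "i - n"] False
      unfolding two sum_lessThan_add P_def SNA_def SNB_def mk_def ab_def by simp
  qed
  have J: "ab j \<in> J" if "j < 2*n" for j
  proof (cases "j < n")
    case True
    thus ?thesis using spectral_decomp_eigenvalue[OF A True] assms(6) unfolding ab_def by auto
  next
    case False
    hence "j - n < n" using that by simp
    thus ?thesis using spectral_decomp_eigenvalue[OF B, of "j - n"] False assms(7) unfolding ab_def by auto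
  qed
  have jensen: "f (mk i) \<le> (\<Sum>j<2*n. P i j * f (ab j))" if "i < 2*n" for i
    using convex_on_sum[of "{..<2*n}" J f "P i" ab] assms(1,5) row[OF that] nonneg J mk[OF that]
    by (auto simp: lessThan_empty_iff)
  have S: "spectral_decomp (2*n) (direct_sum_mat (fun_calc f ?M) (fun_calc f ?N))
      (direct_sum_mat VM VN) (\<lambda>i. f (mk i))"
    using spectral_decomp_direct_sum[OF spectral_decomp_fun_calc[OF M, of f] spectral_decomp_fun_calc[OF N, of f]]
    unfolding two mk_def by (simp add: if_distrib[of f])
  have T: "spectral_decomp (2*n) (fun_calc f (direct_sum_mat A B)) (direct_sum_mat UA UB) (\<lambda>i. f (ab i))"
    using spectral_decomp_fun_calc[OF spectral_decomp_direct_sum[OF A B], of f]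
    unfolding two ab_def .
  show ?thesis
    using loewner_le_average_of_unitary_orbit[of "2*n", OF _ S T nonneg row col jensen] assms(1) by simp
qed

end
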